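(* Let $V$ be a vertex operator algebra, $T\ge1$ an integer, $g_1,g_2,g_3$ commuting automorphisms of $V$ with $g_k^T=1$ and $g_3=g_1g_2$, and let $M^k$ be a $g_k$-twisted $V$-module for $k=1,2,3$ satisfying the standing assumptions in the context. For every intertwining operator $I(\cdot,z)\in\mathcal V^{M^3}_{M^1M^2}$, there exists an $A_{g_1g_2}(V)$-$A_{g_2}(V)$-bimodule epimorphism from $A_{g_1g_2,g_2}(M^1)$ to $S_I=\{o_I(w_1)|_{M^2(0)}: w_1\in M^1\}$.
   Context: All vector spaces are over $\mathbb{C}$; $\mathbb N$ contains $0$. $V=\coprod_{n\in\mathbb Z}V_n$ is a vertex operator algebra (vacuum $\mathbf 1$, conformal vector $\omega$, $\dim V_n<\infty$, $V_n=0$ for $n\ll0$, $Y(\omega,z)=\sum L(n)z^{-n-2}$); $\mathrm{wt}\,u=n$ for $u\in V_n$. Automorphisms of $V$ satisfy $gY(u,z)g^{-1}=Y(gu,z)$ and $g\omega=\omega$. $W\{z\}$ denotes formal series with arbitrary complex powers of $z$. Powers such as $(z_2+z_0)^\alpha$ and $(1+z)^\alpha$ are expanded in nonnegative integer powers of the second variable; $\mathrm{Res}_z$ is the coefficient of $z^{-1}$; $\delta(x)=\sum_{n\in\mathbb Z}x^n$. Twisted modules. Let $g$ be an automorphism with $g^T=1$ and $V^r=\{v: gv=e^{2\pi i r/T}v\}$, $0\le r<T$. A weak $g$-twisted $V$-module is a vector space $M$ with a linear map $Y_M:V\to(\mathrm{End}\,M)\{z\}$ such that: for $u\in V^r$,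 $w\in M$, $Y_M(u,z)w=\sum_{n\in \frac rT+\mathbb Z}u_nwz^{-n-1}$ with $u_nw=0$ for $n\gg0$; $Y_M(\mathbf 1,z)=\mathrm{id}$; and for $u\in V^r$, $v\in V$, $$z_0^{-1}\delta\Big(\frac{z_1-z_2}{z_0}\Big)Y_M(u,z_1)Y_M(v,z_2)-z_0^{-1}\delta\Big(\frac{-z_2+z_1}{z_0}\Big)Y_M(v,z_2)Y_M(u,z_1)=z_1^{-1}\delta\Big(\frac{z_2+z_0}{z_1}\Big)\Big(\frac{z_2+z_0}{z_1}\Big)^{\frac rT}Y_M(Y(u,z_0)v,z_2).$$ A $g$-twisted $V$-module is a weak one with $M=\oplus_{\lambda\in\mathbb C}M_\lambda$, $M_\lambda=\{w: L(0)w=\lambda w\}$, $\dim M_\lambda<\infty$, and $M_{\lambda+n/T}=0$ for all sufficiently negative integers $n$. Standing assumptions: for $k=1,2,3$, $M^k=\oplus_{n\in\mathbb N}M^k_{h_k+n/T}$ for some $h_k\in\mathbb C$, with $L(0)$ acting as $h_k+\frac nT$ on $M^k_{h_k+n/T}$, and $M^k$ is generated by $M^k_{h_k}$. Write $M^k(\frac nT)=M^k_{h_k+n/T}$, and $\deg w=\frac nT$ for $w\in M^k(\frac nT)$. For homogeneous $u\in V$, $o_{M^k}(u)=u_{\mathrm{wt}u-1}$ acting on $M^k$ (zero if this index does not occur in $Y_{M^k}(u,z)$), extended linearly. The algebra $A_g(V)$. Put $\delta(r)=1$ if $r\equiv0\pmod T$, else $\delta(r)=0$. For homogeneous $u\in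 V^r$, $v\in V$ put $u\circ_g v=\mathrm{Res}_z\frac{(1+z)^{\mathrm{wt}u-1+\delta(r)+r/T}}{z^{1+\delta(r)}}Y(u,z)v$, and $u\ast_g v=\mathrm{Res}_z\frac{(1+z)^{\mathrm{wt}u}}{z}Y(u,z)v$ if $r=0$, $u\ast_g v=0$ if $r\ne0$; extend linearly in $u$. $O_g(V)$ is the span of all $u\circ_g v$ and all $(L(-1)+L(0))u$. $A_g(V)=V/O_g(V)$ is known to be an associative algebra under $\ast_g$ with identity $\mathbf 1+O_g(V)$, and $M^2(0)$ (resp. $M^3(0)$) is a left $A_{g_2}(V)$- (resp. $A_{g_1g_2}(V)$-) module with $u+O_g(V)$ acting as $o_{M^2}(u)$ (resp. $o_{M^3}(u)$). Hence $\mathrm{Hom}_{\mathbb C}(M^2(0),M^3(0))$ is an $A_{g_1g_2}(V)$-$A_{g_2}(V)$-bimodule via $(u+O_{g_1g_2}(V))\cdot f=o_{M^3}(u)\circ f$ and $f\cdot(v+O_{g_2}(V))=f\circ o_{M^2}(v)$. The bimodule $A_{g_1g_2,g_2}(M^1)$. $V=\oplus_{0\le j_1,j_2<T}V^{(j_1,j_2)}$, $V^{(j_1,j_2)}=\{v: g_kv=e^{2\pi i j_k/T}v,\ k=1,2\}$. Put $\delta(j_1,j_2)=1$ if $j_2=0$; $=1$ if $j_2\ne0$ and $j_1+j_2\ge T$; $=0$ if $j_2\neq0$ and $j_1+j_2<T$. For homogeneous $u\in V^{(j_1,j_2)}$ and $w_1\in M^1$ define (and extend linearly in $u$): $$u\circ_{g_1g_2,g_2}w_1=\mathrm{Res}_z\frac{(1+z)^{\mathrm{wt}u-1+\delta(j_2)+\frac{j_2}T}}{z^{1+\delta(j_1,j_2)-\frac{j_1}T}}Y_{M^1}(u,z)w_1;$$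 $$u\ast_{g_1g_2,g_2}w_1=\mathrm{Res}_z\frac{(1+z)^{\mathrm{wt}u-1+\delta(j_2)+\frac{j_2}T}}{z^{1-\frac{j_1}T}}Y_{M^1}(u,z)w_1\ \text{ if } j_1+j_2\equiv0\ (\mathrm{mod}\ T),\text{ and }0\text{ otherwise};$$ $$w_1\ast_{g_2,g_1g_2}u=e^{-\frac{j_1}T\pi i}\,\mathrm{Res}_z\frac{(1+z)^{\mathrm{wt}u-1}}{z^{1-\frac{j_1}T}}Y_{M^1}(u,z)w_1\ \text{ if } j_2=0,\text{ and }0\text{ otherwise}.$$ $O'_{g_1g_2,g_2}(M^1)$ is the span of all $u\circ_{g_1g_2,g_2}w_1$. $O''_{g_1g_2,g_2}(M^1)$ is the span of all $(u\ast_{g_1g_2}v)\ast_{g_1g_2,g_2}w_1-u\ast_{g_1g_2,g_2}(v\ast_{g_1g_2,g_2}w_1)$, $w_1\ast_{g_2,g_1g_2}(v\ast_{g_2}u)-(w_1\ast_{g_2,g_1g_2}v)\ast_{g_2,g_1g_2}u$, $u'\ast_{g_1g_2,g_2}w_1$ and $w_1\ast_{g_2,g_1g_2}v'$, with $u,v\in V$, $u'\in O_{g_1g_2}(V)$, $v'\in O_{g_2}(V)$, $w_1\in M^1$. $O_{g_1g_2,g_2}(M^1)=O'_{g_1g_2,g_2}(M^1)+O''_{g_1g_2,g_2}(M^1)$, and $A_{g_1g_2,g_2}(M^1)=M^1/O_{g_1g_2,g_2}(M^1)$ is an $A_{g_1g_2}(V)$-$A_{g_2}(V)$-bimodule with left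 action $\ast_{g_1g_2,g_2}$ and right action $\ast_{g_2,g_1g_2}$. Intertwining operators. $\mathcal V^{M^3}_{M^1M^2}$ is the space of linear maps $I(\cdot,z):M^1\to\mathrm{Hom}(M^2,M^3)\{z\}$ such that: (1) $I(w^1,z)w^2=\sum_{n\in\mathbb C}w^1_nw^2z^{-n-1}$ and, for each fixed $c\in\mathbb C$, $w^1_{c+n}w^2=0$ for $n\in\mathbb Q$, $n\gg0$; (2) for $u\in V^{(j_1,j_2)}$, $w_1\in M^1$, $w_2\in M^2$, $$z_0^{-1}\delta\Big(\frac{z_1-z_2}{z_0}\Big)\Big(\frac{z_1-z_2}{z_0}\Big)^{\frac{j_1}T}Y_{M^3}(u,z_1)I(w_1,z_2)w_2-e^{\frac{j_1}T\pi i}z_0^{-1}\delta\Big(\frac{-z_2+z_1}{z_0}\Big)\Big(\frac{z_2-z_1}{z_0}\Big)^{\frac{j_1}T}I(w_1,z_2)Y_{M^2}(u,z_1)w_2$$ $$=z_1^{-1}\delta\Big(\frac{z_2+z_0}{z_1}\Big)\Big(\frac{z_2+z_0}{z_1}\Big)^{\frac{j_2}T}I(Y_{M^1}(u,z_0)w_1,z_2)w_2;$$ (3) $I(L(-1)w_1,z)=\frac{d}{dz}I(w_1,z)$. For such $I$, put $I^\circ(w_1,z)=z^{h_1+h_2-h_3}I(w_1,z)$; then $I^\circ(w_1,z)=\sum_{n\in\frac1T\mathbb Z}w_1(n)z^{-n-1}$ and, for homogeneous $w_1$, $w_1(n)M^2(m)\subseteq M^3(m+\deg w_1-n-1)$.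 Put $o_I(w_1)=w_1(\deg w_1-1)$ for homogeneous $w_1$, extended linearly to $M^1$. $S_I$ is a sub-bimodule of $\mathrm{Hom}_{\mathbb C}(M^2(0),M^3(0))$ and is regarded as a bimodule in this way. *)

theory Defs
  imports Complex_Main "HOL-Library.FuncSet" "HOL-Library.Groups_Big_Fun"
begin

section \<open>Direct sums and linear extension\<close>

definition decomposes :: "'i set \<Rightarrow> ('i \<Rightarrow> 'v::ab_group_add set) \<Rightarrow> 'v \<Rightarrow> ('i \<Rightarrow> 'v) \<Rightarrow> bool" where
  "decomposes J W v f \<longleftrightarrow>
     (\<forall>i\<in>J. f i \<in> W i) \<and> (\<forall>i. i \<notin> J \<longrightarrow> f i = 0) \<and> finite {i. f i \<noteq> 0} \<and> v = Sum_any f"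

definition direct_sum :: "'i set \<Rightarrow> ('i \<Rightarrow> 'v::ab_group_add set) \<Rightarrow> bool" where
  "direct_sum J W \<longleftrightarrow> (\<forall>v. \<exists>!f. decomposes J W v f)"

definition components :: "'i set \<Rightarrow> ('i \<Rightarrow> 'v::ab_group_add set) \<Rightarrow> 'v \<Rightarrow> 'i \<Rightarrow> 'v" where
  "components J W v = (THE f. decomposes J W v f)"

text \<open>The linear extension of a family of maps, the \<open>i\<close>-th one being given on the
  \<open>i\<close>-th summand of a direct sum decomposition.\<close>

definition lin_ext ::
  "'i set \<Rightarrow> ('i \<Rightarrow> 'v::ab_group_add set) \<Rightarrow> ('i \<Rightarrow> 'v \<Rightarrow> 'w::comm_monoid_add) \<Rightarrow> 'v \<Rightarrow> 'w" where
  "lin_ext J W F v = Sum_any (\<lambda>i. F i (components J W v i))"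

definition finite_dim :: "(complex \<Rightarrow> 'v::ab_group_add \<Rightarrow> 'v) \<Rightarrow> 'v set \<Rightarrow> bool" where
  "finite_dim s W \<longleftrightarrow> (\<exists>B. finite B \<and> W \<subseteq> module.span s B)"

section \<open>Formal series\<close>

text \<open>A formal series \<open>\<Sum>\<^sub>n F\<^sub>n z\<^bsup>-n-1\<^esup>\<close> with arbitrary complex exponents is the function \<open>F\<close> of
  \<open>n :: complex\<close>. All sums over \<open>i\<close> below have finite support when the truncation
  conditions hold; \<open>Sum_any\<close> is the sum over the support.

  \<open>res_binom s a b F\<close> is \<open>Res\<^sub>z (1+z)\<^sup>a z\<^bsup>-b\<^esup> F(z)\<close>, where the \<open>i\<close>-th term of the binomial expansion
  contributes \<open>z\<^bsup>i-b\<^esup>\<close> and so picks out the mode \<open>n = i - b\<close>.\<close>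

definition res_binom ::
  "(complex \<Rightarrow> 'w::ab_group_add \<Rightarrow> 'w) \<Rightarrow> complex \<Rightarrow> complex \<Rightarrow> (complex \<Rightarrow> 'w) \<Rightarrow> 'w" where
  "res_binom s a b F = Sum_any (\<lambda>i::nat. s (a gchoose i) (F (of_nat i - b)))"

text \<open>The coefficients of \<open>z\<^sub>0\<^bsup>-l-1\<^esup> z\<^sub>1\<^bsup>-m-1\<^esup> z\<^sub>2\<^bsup>-k-1\<^esup>\<close> in, respectively,
  \<^item> \<open>z\<^sub>0\<^bsup>-1\<^esup> \<delta>((z\<^sub>1-z\<^sub>2)/z\<^sub>0) ((z\<^sub>1-z\<^sub>2)/z\<^sub>0)\<^sup>\<alpha> \<Sum> A p q z\<^sub>1\<^bsup>-p-1\<^esup> z\<^sub>2\<^bsup>-q-1\<^esup>\<close>,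
  \<^item> \<open>z\<^sub>0\<^bsup>-1\<^esup> \<delta>((-z\<^sub>2+z\<^sub>1)/z\<^sub>0) ((z\<^sub>2-z\<^sub>1)/z\<^sub>0)\<^sup>\<alpha> \<Sum> A p q z\<^sub>1\<^bsup>-p-1\<^esup> z\<^sub>2\<^bsup>-q-1\<^esup>\<close>,
  \<^item> \<open>z\<^sub>1\<^bsup>-1\<^esup> \<delta>((z\<^sub>2+z\<^sub>0)/z\<^sub>1) ((z\<^sub>2+z\<^sub>0)/z\<^sub>1)\<^sup>\<beta> \<Sum> A p q z\<^sub>0\<^bsup>-p-1\<^esup> z\<^sub>2\<^bsup>-q-1\<^esup>\<close>.

  For instance the first prefactor is \<open>\<Sum>\<^sub>n z\<^sub>0\<^bsup>-(n+\<alpha>)-1\<^esup> (z\<^sub>1-z\<^sub>2)\<^bsup>n+\<alpha>\<^esup>\<close> with \<open>n\<close> an integer, so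
  that \<open>l = n + \<alpha>\<close>; the power is expanded in nonnegative powers of \<open>z\<^sub>2\<close>. In the second one
  \<open>(-z\<^sub>2+z\<^sub>1)\<^sup>n = (-1)\<^sup>n (z\<^sub>2-z\<^sub>1)\<^sup>n\<close>, whence the sign with \<open>n = l - \<alpha>\<close>.\<close>

definition delta_z1_z2 ::
  "(complex \<Rightarrow> 'w::ab_group_add \<Rightarrow> 'w) \<Rightarrow> complex \<Rightarrow> (complex \<Rightarrow> complex \<Rightarrow> 'w) \<Rightarrow>
     complex \<Rightarrow> complex \<Rightarrow> complex \<Rightarrow> 'w" where
  "delta_z1_z2 s \<alpha> A l m k =
     (if l - \<alpha> \<in> \<int>
      then Sum_any (\<lambda>i::nat. s ((-1) ^ i * (l gchoose i)) (A (m + l - of_nat i) (k + of_nat i)))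
      else 0)"

definition delta_z2_z1 ::
  "(complex \<Rightarrow> 'w::ab_group_add \<Rightarrow> 'w) \<Rightarrow> complex \<Rightarrow> (complex \<Rightarrow> complex \<Rightarrow> 'w) \<Rightarrow>
     complex \<Rightarrow> complex \<Rightarrow> complex \<Rightarrow> 'w" where
  "delta_z2_z1 s \<alpha> A l m k =
     (if l - \<alpha> \<in> \<int>
      then s ((-1) powi \<lfloor>Re (l - \<alpha>)\<rfloor>)
        (Sum_any (\<lambda>i::nat. s ((-1) ^ i * (l gchoose i)) (A (m + of_nat i) (k + l - of_nat i))))
      else 0)"

definition delta_z2_z0 ::
  "(complex \<Rightarrow> 'w::ab_group_add \<Rightarrow> 'w) \<Rightarrow> complex \<Rightarrow> (complex \<Rightarrow> complex \<Rightarrow> 'w) \<Rightarrow>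
     complex \<Rightarrow> complex \<Rightarrow> complex \<Rightarrow> 'w" where
  "delta_z2_z0 s \<beta> A l m k =
     (if m - \<beta> \<in> \<int>
      then Sum_any (\<lambda>i::nat. s (m gchoose i) (A (l + of_nat i) (m + k - of_nat i)))
      else 0)"

section \<open>Vertex operator algebras\<close>

text \<open>\<open>mode M u n w\<close> is \<open>u\<^sub>n w\<close>, i.e. the coefficient of \<open>z\<^bsup>-n-1\<^esup>\<close> in \<open>Y\<^sub>M(u,z)w\<close>. A vertex
  operator algebra has the data of a module over itself, so its modes too are indexed by
  complex numbers (the ones with non-integral index being zero).\<close>

record ('v, 'm) vmod =
  scal :: "complex \<Rightarrow> 'm \<Rightarrow> 'm"
  mode :: "'v \<Rightarrow> complex \<Rightarrow> 'm \<Rightarrow> 'm"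

record 'v voa = "('v, 'v) vmod" +
  vac :: 'v
  conf :: 'v

definition vir :: "'v voa \<Rightarrow> ('v, 'm, 'z) vmod_scheme \<Rightarrow> int \<Rightarrow> 'm \<Rightarrow> 'm" where
  "vir V M n = mode M (conf V) (of_int n + 1)"

definition wt_space :: "'v voa \<Rightarrow> ('v, 'm, 'z) vmod_scheme \<Rightarrow> complex \<Rightarrow> 'm set" where
  "wt_space V M l = {w. vir V M 0 w = scal M l w}"

definition vertex_operator_algebra :: "'v::ab_group_add voa \<Rightarrow> bool" where
  "vertex_operator_algebra V \<longleftrightarrow>
     vector_space (scal V) \<and>
     (\<forall>n v. Vector_Spaces.linear (scal V) (scal V) (\<lambda>u. mode V u n v)) \<and>
     (\<forall>u n. Vector_Spaces.linear (scal V) (scal V) (mode V u n)) \<and>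
     (\<forall>u n v. n \<notin> \<int> \<longrightarrow> mode V u n v = 0) \<and>
     (\<forall>u v. \<exists>N. \<forall>n\<ge>N. mode V u (of_int n) v = 0) \<and>
     (\<forall>n v. mode V (vac V) n v = (if n = -1 then v else 0)) \<and>
     (\<forall>u. mode V u (-1) (vac V) = u \<and> (\<forall>n::nat. mode V u (of_nat n) (vac V) = 0)) \<and>
     (\<forall>u v w l m k.
        delta_z1_z2 (scal V) 0 (\<lambda>p q. mode V u p (mode V v q w)) l m k
        - delta_z2_z1 (scal V) 0 (\<lambda>p q. mode V v q (mode V u p w)) l m k
        = delta_z2_z0 (scal V) 0 (\<lambda>p q. mode V (mode V u p v) q w) l m k) \<and>
     (\<exists>c. \<forall>m n v.
        vir V V m (vir V V n v) - vir V V n (vir V V m v) =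
          scal V (of_int (m - n)) (vir V V (m + n) v)
          + (if m + n = 0 then scal V (of_int (m ^ 3 - m) / 12 * c) v else 0)) \<and>
     (\<forall>u n v. mode V (vir V V (-1) u) n v = scal V (- n) (mode V u (n - 1) v)) \<and>
     direct_sum UNIV (\<lambda>n::int. wt_space V V (of_int n)) \<and>
     (\<forall>n::int. finite_dim (scal V) (wt_space V V (of_int n))) \<and>
     (\<exists>N::int. \<forall>n<N. wt_space V V (of_int n) = {0}) \<and>
     vac V \<in> wt_space V V 0 \<and> conf V \<in> wt_space V V 2"

definition voa_automorphism :: "'v::ab_group_add voa \<Rightarrow> ('v \<Rightarrow> 'v) \<Rightarrow> bool" where
  "voa_automorphism V g \<longleftrightarrow>
     Vector_Spaces.linear (scal V) (scal V) g \<and> bij g \<and>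
     (\<forall>u n. g \<circ> mode V u n \<circ> inv g = mode V (g u) n) \<and> g (conf V) = conf V"

definition eigen_space :: "'v voa \<Rightarrow> nat \<Rightarrow> ('v \<Rightarrow> 'v) \<Rightarrow> nat \<Rightarrow> 'v set" where
  "eigen_space V T g r =
     {v. g v = scal V (exp (2 * complex_of_real pi * \<i> * of_nat r / of_nat T)) v}"

section \<open>Twisted modules\<close>

definition weak_twisted_module ::
  "'v::ab_group_add voa \<Rightarrow> nat \<Rightarrow> ('v \<Rightarrow> 'v) \<Rightarrow> ('v, 'm::ab_group_add) vmod \<Rightarrow> bool" where
  "weak_twisted_module V T g M \<longleftrightarrow>
     vector_space (scal M) \<and>
     (\<forall>n w. Vector_Spaces.linear (scal V) (scal M) (\<lambda>u. mode M u n w)) \<and>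
     (\<forall>u n. Vector_Spaces.linear (scal M) (scal M) (mode M u n)) \<and>
     (\<forall>r<T. \<forall>u \<in> eigen_space V T g r. \<forall>w.
        (\<forall>n. n - of_nat r / of_nat T \<notin> \<int> \<longrightarrow> mode M u n w = 0) \<and>
        (\<exists>N. \<forall>n\<ge>N. mode M u (of_nat r / of_nat T + of_int n) w = 0)) \<and>
     (\<forall>n w. mode M (vac V) n w = (if n = -1 then w else 0)) \<and>
     (\<forall>r<T. \<forall>u \<in> eigen_space V T g r. \<forall>v w l m k.
        delta_z1_z2 (scal M) 0 (\<lambda>p q. mode M u p (mode M v q w)) l m k
        - delta_z2_z1 (scal M) 0 (\<lambda>p q. mode M v q (mode M u p w)) l m k
        = delta_z2_z0 (scal M) (of_nat r / of_nat T) (\<lambda>p q. mode M (mode V u p v) q w) l m k)"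

definition twisted_module ::
  "'v::ab_group_add voa \<Rightarrow> nat \<Rightarrow> ('v \<Rightarrow> 'v) \<Rightarrow> ('v, 'm::ab_group_add) vmod \<Rightarrow> bool" where
  "twisted_module V T g M \<longleftrightarrow>
     weak_twisted_module V T g M \<and>
     direct_sum UNIV (wt_space V M) \<and>
     (\<forall>l. finite_dim (scal M) (wt_space V M l)) \<and>
     (\<forall>l. \<exists>N::int. \<forall>n<N. wt_space V M (l + of_int n / of_nat T) = {0})"

text \<open>\<open>deg_space V T h M n\<close> is \<open>M(n/T)\<close>, the space of vectors of degree \<open>n/T\<close>.\<close>

definition deg_space ::
  "'v voa \<Rightarrow> nat \<Rightarrow> complex \<Rightarrow> ('v, 'm) vmod \<Rightarrow> nat \<Rightarrow> 'm set" where
  "deg_space V T h M n = wt_space V M (h + of_nat n / of_nat T)"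

definition generated_by :: "('v, 'm::ab_group_add) vmod \<Rightarrow> 'm set \<Rightarrow> bool" where
  "generated_by M X \<longleftrightarrow>
     (\<forall>S. module.subspace (scal M) S \<and> X \<subseteq> S \<and> (\<forall>u n. \<forall>w\<in>S. mode M u n w \<in> S) \<longrightarrow> S = UNIV)"

definition graded_generated ::
  "'v voa \<Rightarrow> nat \<Rightarrow> complex \<Rightarrow> ('v, 'm::ab_group_add) vmod \<Rightarrow> bool" where
  "graded_generated V T h M \<longleftrightarrow>
     direct_sum UNIV (deg_space V T h M) \<and> generated_by M (wt_space V M h)"

definition o_mod :: "'v::ab_group_add voa \<Rightarrow> ('v, 'm::ab_group_add) vmod \<Rightarrow> 'v \<Rightarrow> 'm \<Rightarrow> 'm" where
  "o_mod V M u w =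
     lin_ext UNIV (\<lambda>n::int. wt_space V V (of_int n)) (\<lambda>n u'. mode M u' (of_int n - 1) w) u"

section \<open>The algebra \<open>A\<^sub>g(V)\<close>\<close>

definition delta1 :: "nat \<Rightarrow> nat \<Rightarrow> complex" where
  "delta1 T r = (if T dvd r then 1 else 0)"

definition graded_eigen :: "'v voa \<Rightarrow> nat \<Rightarrow> ('v \<Rightarrow> 'v) \<Rightarrow> int \<times> nat \<Rightarrow> 'v set" where
  "graded_eigen V T g = (\<lambda>(n, r). wt_space V V (of_int n) \<inter> eigen_space V T g r)"

definition circ :: "'v::ab_group_add voa \<Rightarrow> nat \<Rightarrow> ('v \<Rightarrow> 'v) \<Rightarrow> 'v \<Rightarrow> 'v \<Rightarrow> 'v" where
  "circ V T g u v =
     lin_ext (UNIV \<times> {..<T}) (graded_eigen V T g)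
       (\<lambda>(n, r) u'. res_binom (scal V)
          (of_int n - 1 + delta1 T r + of_nat r / of_nat T) (1 + delta1 T r)
          (\<lambda>p. mode V u' p v)) u"

definition star :: "'v::ab_group_add voa \<Rightarrow> nat \<Rightarrow> ('v \<Rightarrow> 'v) \<Rightarrow> 'v \<Rightarrow> 'v \<Rightarrow> 'v" where
  "star V T g u v =
     lin_ext (UNIV \<times> {..<T}) (graded_eigen V T g)
       (\<lambda>(n, r) u'. if r = 0 then res_binom (scal V) (of_int n) 1 (\<lambda>p. mode V u' p v) else 0) u"

definition O_alg :: "'v::ab_group_add voa \<Rightarrow> nat \<Rightarrow> ('v \<Rightarrow> 'v) \<Rightarrow> 'v set" where
  "O_alg V T g = module.span (scal V)
     ({circ V T g u v | u v. True} \<union> {vir V V (-1) u + vir V V 0 u | u. True})"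

text \<open>Cosets, and the operation on cosets induced by an operation on representatives (written
  as a union, as for factor groups and factor rings in HOL-Algebra).\<close>

definition coset :: "'m::ab_group_add set \<Rightarrow> 'm \<Rightarrow> 'm set" where
  "coset N x = (\<lambda>y. x + y) ` N"

definition lift_coset2 ::
  "'m::ab_group_add set \<Rightarrow> ('a \<Rightarrow> 'b \<Rightarrow> 'm) \<Rightarrow> 'a set \<Rightarrow> 'b set \<Rightarrow> 'm set" where
  "lift_coset2 N f X Y = (\<Union>x\<in>X. \<Union>y\<in>Y. coset N (f x y))"

definition A_alg :: "'v::ab_group_add voa \<Rightarrow> nat \<Rightarrow> ('v \<Rightarrow> 'v) \<Rightarrow> 'v set set" where
  "A_alg V T g = range (coset (O_alg V T g))"

section \<open>Bimodules\<close>

text \<open>The data of an \<open>A\<close>-\<open>B\<close>-bimodule over the complex numbers; as with \<open>hom\<close> and \<open>epi\<close> in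
  HOL-Algebra, morphisms are defined on the level of the data.\<close>

record ('r, 's, 'x) bimod =
  bcarrier :: "'x set"
  badd :: "'x \<Rightarrow> 'x \<Rightarrow> 'x"
  bscal :: "complex \<Rightarrow> 'x \<Rightarrow> 'x"
  lact :: "'r \<Rightarrow> 'x \<Rightarrow> 'x"
  ract :: "'x \<Rightarrow> 's \<Rightarrow> 'x"

definition bimodule_hom ::
  "'r set \<Rightarrow> 's set \<Rightarrow> ('r, 's, 'x) bimod \<Rightarrow> ('r, 's, 'y) bimod \<Rightarrow> ('x \<Rightarrow> 'y) set" where
  "bimodule_hom A B X Y =
     {\<phi> \<in> bcarrier X \<rightarrow> bcarrier Y.
       (\<forall>x\<in>bcarrier X. \<forall>x'\<in>bcarrier X. \<phi> (badd X x x') = badd Y (\<phi> x) (\<phi> x')) \<and>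
       (\<forall>c. \<forall>x\<in>bcarrier X. \<phi> (bscal X c x) = bscal Y c (\<phi> x)) \<and>
       (\<forall>a\<in>A. \<forall>x\<in>bcarrier X. \<phi> (lact X a x) = lact Y a (\<phi> x)) \<and>
       (\<forall>b\<in>B. \<forall>x\<in>bcarrier X. \<phi> (ract X x b) = ract Y (\<phi> x) b)}"

definition bimodule_epi ::
  "'r set \<Rightarrow> 's set \<Rightarrow> ('r, 's, 'x) bimod \<Rightarrow> ('r, 's, 'y) bimod \<Rightarrow> ('x \<Rightarrow> 'y) set" where
  "bimodule_epi A B X Y = {\<phi> \<in> bimodule_hom A B X Y. \<phi> ` bcarrier X = bcarrier Y}"

section \<open>The bimodule \<open>A\<^bsub>g\<^sub>1g\<^sub>2,g\<^sub>2\<^esub>(M\<^sup>1)\<close>\<close>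

definition delta2 :: "nat \<Rightarrow> nat \<Rightarrow> nat \<Rightarrow> complex" where
  "delta2 T j1 j2 = (if j2 = 0 \<or> j1 + j2 \<ge> T then 1 else 0)"

definition graded_eigen2 ::
  "'v voa \<Rightarrow> nat \<Rightarrow> ('v \<Rightarrow> 'v) \<Rightarrow> ('v \<Rightarrow> 'v) \<Rightarrow> int \<times> nat \<times> nat \<Rightarrow> 'v set" where
  "graded_eigen2 V T g1 g2 =
     (\<lambda>(n, j1, j2). wt_space V V (of_int n) \<inter> eigen_space V T g1 j1 \<inter> eigen_space V T g2 j2)"

definition circ_mod ::
  "'v::ab_group_add voa \<Rightarrow> nat \<Rightarrow> ('v \<Rightarrow> 'v) \<Rightarrow> ('v \<Rightarrow> 'v) \<Rightarrow> ('v, 'm::ab_group_add) vmod \<Rightarrow>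
     'v \<Rightarrow> 'm \<Rightarrow> 'm" where
  "circ_mod V T g1 g2 M u w =
     lin_ext (UNIV \<times> {..<T} \<times> {..<T}) (graded_eigen2 V T g1 g2)
       (\<lambda>(n, j1, j2) u'. res_binom (scal M)
          (of_int n - 1 + delta1 T j2 + of_nat j2 / of_nat T)
          (1 + delta2 T j1 j2 - of_nat j1 / of_nat T)
          (\<lambda>p. mode M u' p w)) u"

definition left_star ::
  "'v::ab_group_add voa \<Rightarrow> nat \<Rightarrow> ('v \<Rightarrow> 'v) \<Rightarrow> ('v \<Rightarrow> 'v) \<Rightarrow> ('v, 'm::ab_group_add) vmod \<Rightarrow>
     'v \<Rightarrow> 'm \<Rightarrow> 'm" where
  "left_star V T g1 g2 M u w =
     lin_ext (UNIV \<times> {..<T} \<times> {..<T}) (graded_eigen2 V T g1 g2)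
       (\<lambda>(n, j1, j2) u'.
          if T dvd j1 + j2 then
            res_binom (scal M)
              (of_int n - 1 + delta1 T j2 + of_nat j2 / of_nat T)
              (1 - of_nat j1 / of_nat T)
              (\<lambda>p. mode M u' p w)
          else 0) u"

definition right_star ::
  "'v::ab_group_add voa \<Rightarrow> nat \<Rightarrow> ('v \<Rightarrow> 'v) \<Rightarrow> ('v \<Rightarrow> 'v) \<Rightarrow> ('v, 'm::ab_group_add) vmod \<Rightarrow>
     'm \<Rightarrow> 'v \<Rightarrow> 'm" where
  "right_star V T g1 g2 M w u =
     lin_ext (UNIV \<times> {..<T} \<times> {..<T}) (graded_eigen2 V T g1 g2)
       (\<lambda>(n, j1, j2) u'.
          if j2 = 0 then
            scal M (exp (- (of_nat j1 / of_nat T * complex_of_real pi * \<i>)))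
              (res_binom (scal M) (of_int n - 1) (1 - of_nat j1 / of_nat T)
                (\<lambda>p. mode M u' p w))
          else 0) u"

definition O_mod' ::
  "'v::ab_group_add voa \<Rightarrow> nat \<Rightarrow> ('v \<Rightarrow> 'v) \<Rightarrow> ('v \<Rightarrow> 'v) \<Rightarrow> ('v, 'm::ab_group_add) vmod \<Rightarrow>
     'm set" where
  "O_mod' V T g1 g2 M = module.span (scal M) {circ_mod V T g1 g2 M u w | u w. True}"

definition O_mod'' ::
  "'v::ab_group_add voa \<Rightarrow> nat \<Rightarrow> ('v \<Rightarrow> 'v) \<Rightarrow> ('v \<Rightarrow> 'v) \<Rightarrow> ('v, 'm::ab_group_add) vmod \<Rightarrow>
     'm set" where
  "O_mod'' V T g1 g2 M =
     (let L = left_star V T g1 g2 M; R = right_star V T g1 g2 M in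
      module.span (scal M)
       ({L (star V T (g1 \<circ> g2) u v) w - L u (L v w) | u v w. True} \<union>
        {R w (star V T g2 v u) - R (R w v) u | u v w. True} \<union>
        {L u w | u w. u \<in> O_alg V T (g1 \<circ> g2)} \<union>
        {R w v | v w. v \<in> O_alg V T g2}))"

definition O_mod ::
  "'v::ab_group_add voa \<Rightarrow> nat \<Rightarrow> ('v \<Rightarrow> 'v) \<Rightarrow> ('v \<Rightarrow> 'v) \<Rightarrow> ('v, 'm::ab_group_add) vmod \<Rightarrow>
     'm set" where
  "O_mod V T g1 g2 M = {x + y | x y. x \<in> O_mod' V T g1 g2 M \<and> y \<in> O_mod'' V T g1 g2 M}"

definition A_bimod ::
  "'v::ab_group_add voa \<Rightarrow> nat \<Rightarrow> ('v \<Rightarrow> 'v) \<Rightarrow> ('v \<Rightarrow> 'v) \<Rightarrow> ('v, 'm::ab_group_add) vmod \<Rightarrow>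
     ('v set, 'v set, 'm set) bimod" where
  "A_bimod V T g1 g2 M =
     (let N = O_mod V T g1 g2 M in
      \<lparr> bcarrier = range (coset N),
        badd = lift_coset2 N (+),
        bscal = (\<lambda>c X. \<Union>w\<in>X. coset N (scal M c w)),
        lact = lift_coset2 N (left_star V T g1 g2 M),
        ract = lift_coset2 N (right_star V T g1 g2 M) \<rparr>)"

section \<open>Intertwining operators\<close>

text \<open>\<open>I w1 n w2\<close> is \<open>w\<^sup>1\<^sub>n w\<^sup>2\<close>, the coefficient of \<open>z\<^bsup>-n-1\<^esup>\<close> in \<open>I(w\<^sup>1,z)w\<^sup>2\<close>.\<close>

definition intertwining_operators ::
  "'v::ab_group_add voa \<Rightarrow> nat \<Rightarrow> ('v \<Rightarrow> 'v) \<Rightarrow> ('v \<Rightarrow> 'v) \<Rightarrow>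
     ('v, 'a::ab_group_add) vmod \<Rightarrow> ('v, 'b::ab_group_add) vmod \<Rightarrow> ('v, 'c::ab_group_add) vmod \<Rightarrow>
     ('a \<Rightarrow> complex \<Rightarrow> 'b \<Rightarrow> 'c) set" where
  "intertwining_operators V T g1 g2 M1 M2 M3 =
     {I.
       (\<forall>n w2. Vector_Spaces.linear (scal M1) (scal M3) (\<lambda>w1. I w1 n w2)) \<and>
       (\<forall>w1 n. Vector_Spaces.linear (scal M2) (scal M3) (I w1 n)) \<and>
       (\<forall>w1 w2 c. \<exists>N::rat. \<forall>n\<ge>N. I w1 (c + of_rat n) w2 = 0) \<and>
       (\<forall>j1<T. \<forall>j2<T. \<forall>u \<in> eigen_space V T g1 j1 \<inter> eigen_space V T g2 j2. \<forall>w1 w2 l m k.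
          delta_z1_z2 (scal M3) (of_nat j1 / of_nat T)
            (\<lambda>p q. mode M3 u p (I w1 q w2)) l m k
          - scal M3 (exp (of_nat j1 / of_nat T * complex_of_real pi * \<i>))
              (delta_z2_z1 (scal M3) (of_nat j1 / of_nat T)
                (\<lambda>p q. I w1 q (mode M2 u p w2)) l m k)
          = delta_z2_z0 (scal M3) (of_nat j2 / of_nat T)
              (\<lambda>p q. I (mode M1 u p w1) q w2) l m k) \<and>
       (\<forall>w1 n w2. I (vir V M1 (-1) w1) n w2 = scal M3 (- n) (I w1 (n - 1) w2))}"

text \<open>Multiplication by \<open>z\<^bsup>h1+h2-h3\<^esup>\<close> shifts modes: \<open>w\<^sub>1(n)\<close> is the mode of \<open>I(w\<^sub>1,z)\<close> of index
  \<open>n + h1 + h2 - h3\<close>.\<close>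

definition o_int ::
  "'v voa \<Rightarrow> nat \<Rightarrow> complex \<Rightarrow> complex \<Rightarrow> complex \<Rightarrow> ('v, 'a::ab_group_add) vmod \<Rightarrow>
     ('a \<Rightarrow> complex \<Rightarrow> 'b \<Rightarrow> 'c::ab_group_add) \<Rightarrow> 'a \<Rightarrow> 'b \<Rightarrow> 'c" where
  "o_int V T h1 h2 h3 M1 I w1 w2 =
     lin_ext UNIV (deg_space V T h1 M1)
       (\<lambda>n w. I w (of_nat n / of_nat T - 1 + (h1 + h2 - h3)) w2) w1"

text \<open>Linear maps between the subspaces \<open>M\<^sup>2(0)\<close> and \<open>M\<^sup>3(0)\<close> are represented by functions that are
  undefined outside \<open>M\<^sup>2(0)\<close>. A class in \<open>A\<^sub>g(V)\<close> acts through any of its representatives; the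
  image of the class below is therefore a singleton.\<close>

definition Hom_bimod ::
  "'v::ab_group_add voa \<Rightarrow> complex \<Rightarrow> complex \<Rightarrow>
     ('v, 'b::ab_group_add) vmod \<Rightarrow> ('v, 'c::ab_group_add) vmod \<Rightarrow>
     ('v set, 'v set, 'b \<Rightarrow> 'c) bimod" where
  "Hom_bimod V h2 h3 M2 M3 =
     (let D = wt_space V M2 h2; E = wt_space V M3 h3 in
      \<lparr> bcarrier = {f \<in> D \<rightarrow>\<^sub>E E.
          (\<forall>x\<in>D. \<forall>y\<in>D. f (x + y) = f x + f y) \<and>
          (\<forall>c. \<forall>x\<in>D. f (scal M2 c x) = scal M3 c (f x))},
        badd = (\<lambda>f f'. \<lambda>x\<in>D. f x + f' x),
        bscal = (\<lambda>c f. \<lambda>x\<in>D. scal M3 c (f x)),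
        lact = (\<lambda>a f. the_elem ((\<lambda>u. \<lambda>x\<in>D. o_mod V M3 u (f x)) ` a)),
        ract = (\<lambda>f b. the_elem ((\<lambda>v. \<lambda>x\<in>D. f (o_mod V M2 v x)) ` b)) \<rparr>)"

definition S_bimod ::
  "'v::ab_group_add voa \<Rightarrow> nat \<Rightarrow> complex \<Rightarrow> complex \<Rightarrow> complex \<Rightarrow>
     ('v, 'a::ab_group_add) vmod \<Rightarrow> ('v, 'b::ab_group_add) vmod \<Rightarrow> ('v, 'c::ab_group_add) vmod \<Rightarrow>
     ('a \<Rightarrow> complex \<Rightarrow> 'b \<Rightarrow> 'c) \<Rightarrow> ('v set, 'v set, 'b \<Rightarrow> 'c) bimod" where
  "S_bimod V T h1 h2 h3 M1 M2 M3 I =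
     (Hom_bimod V h2 h3 M2 M3)
       \<lparr> bcarrier := range (\<lambda>w1. restrict (o_int V T h1 h2 h3 M1 I w1) (wt_space V M2 h2)) \<rparr>"

end

(* Let u be homogeneous of weight n in V^(j1,j2), w1 homogeneous in M1 and w2 in M2(0). For each of
   the three products of u and w1, o_I of the product applied to w2 is a single coefficient of the
   right-hand side of the Jacobi identity for I. Since no vectors of negative degree exist in M2
   and M3, at most one term survives on the left-hand side of that coefficient: none for the circle
   product, o(u) o_I(w1) w2 for the left action and o_I(w1) o(u) w2 for the right action. The case
   of V acting on a single twisted module (j1 = 0) shows that o is an action of A_g(V) on the lowest
   weight space. Hence o_I kills O(M1) on M2(0), and the induced map on cosets is the epimorphism. *)
theory Submission
  imports Defs
begin

section \<open>Direct sums\<close>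

text \<open>For a residue against (1+z)^a z^(-b), two numbers decide everything: a-n-b+1 and n-1-a.
  In the matching Jacobi coefficient, the i-th term of the first product contains a mode of w1 that
  kills w2 once i exceeds the real part of the first number; the i-th term of the second contains a
  mode of u that kills w2 once i exceeds that of the second. The exponents in the definitions, with
  the corrections \<open>delta1\<close> and \<open>delta2\<close>, are tuned to this: both numbers
  are negative for the circle product, they are 0 and negative for the left action, negative and 0
  for the right action. Two obstacles come before. The products are linear extensions from
  simultaneous weight and eigenvalue spaces, while V is given as a sum of weight spaces only; the
  finer decomposition is built by averaging over the cyclic groups generated by the automorphisms.
  And the vanishing of modes rests on weights, hence on commutators with L(0), which involve modes
  of L(-1)u; on twisted modules the L(-1)-derivative property is not an axiom and has to be
  extracted from the Jacobi identity.\<close>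

lemma Sum_any_hom:
  assumes "f 0 = 0" and "\<And>x y. f (x + y) = f x + f y" and "finite {i. F i \<noteq> 0}"
  shows "f (Sum_any F) = Sum_any (\<lambda>i. f (F i))"
proof -
  have "f (sum F A) = sum (\<lambda>i. f (F i)) A" if "finite A" for A
    using that by induction (simp_all add: assms)
  moreover have "Sum_any (\<lambda>i. f (F i)) = sum (\<lambda>i. f (F i)) {i. F i \<noteq> 0}"
    using assms by (intro Sum_any.expand_superset) auto
  ultimately show ?thesis
    using assms(3) by (simp add: Sum_any.expand_set)
qed

lemma Sum_any_eq_single:
  assumes "\<And>i. i \<noteq> j \<Longrightarrow> F i = 0"
  shows "Sum_any F = F j"
proof -
  have "Sum_any F = sum F {j}"
    using assms by (intro Sum_any.expand_superset) auto
  then show ?thesis by simp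
qed

lemma linear_add: "Vector_Spaces.linear s s' f \<Longrightarrow> f (x + y) = f x + f y"
  by (rule module_hom.add[OF Vector_Spaces.linear.axioms(3)])

lemma linear_scale: "Vector_Spaces.linear s s' f \<Longrightarrow> f (s c x) = s' c (f x)"
  by (rule module_hom.scale[OF Vector_Spaces.linear.axioms(3)])

lemma linear_0: "Vector_Spaces.linear s s' f \<Longrightarrow> f 0 = 0"
  by (rule module_hom.zero[OF Vector_Spaces.linear.axioms(3)])

lemma linear_diff: "Vector_Spaces.linear s s' f \<Longrightarrow> f (x - y) = f x - f y"
  by (rule module_hom.diff[OF Vector_Spaces.linear.axioms(3)])

lemma linear_Sum_any:
  "Vector_Spaces.linear s s' f \<Longrightarrow> finite {i. F i \<noteq> 0} \<Longrightarrow> f (Sum_any F) = Sum_any (\<lambda>i. f (F i))"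
  by (rule Sum_any_hom) (auto simp: linear_0 linear_add)

text \<open>Serves three kinds of index: the integral weights of V, the degrees of a twisted module,
  and weights paired with one or two eigenvalue exponents.\<close>

locale graded_vector_space = vector_space s
  for s :: "complex \<Rightarrow> 'v::ab_group_add \<Rightarrow> 'v" and J :: "'i set" and W :: "'i \<Rightarrow> 'v set" +
  assumes direct: "direct_sum J W"
    and subspace_summand: "i \<in> J \<Longrightarrow> subspace (W i)"
begin

lemma decomposes_components: "decomposes J W v (components J W v)"
  unfolding components_def by (rule theI'[OF direct[unfolded direct_sum_def, THEN spec]])

lemma components_eqI: "decomposes J W v f \<Longrightarrow> components J W v = f"
  using ex1E[OF direct[unfolded direct_sum_def, THEN spec, of v]] decomposes_components[of v]
  by metis

lemma components_mem: "i \<in> J \<Longrightarrow> components J W v i \<in> W i"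
  and components_outside: "i \<notin> J \<Longrightarrow> components J W v i = 0"
  and finite_components: "finite {i. components J W v i \<noteq> 0}"
  and Sum_any_components: "Sum_any (components J W v) = v"
  using decomposes_components[of v, unfolded decomposes_def] by (blast, blast, blast, metis)

lemma components_homogeneous:
  assumes "j \<in> J" "w \<in> W j"
  shows "components J W w = (\<lambda>i. if i = j then w else 0)"
proof (rule components_eqI)
  have "finite {i. (if i = j then w else 0) \<noteq> 0}"
    by (rule finite_subset[of _ "{j}"]) auto
  moreover have "Sum_any (\<lambda>i. if i = j then w else 0) = w"
    by (subst Sum_any_eq_single[of j]) auto
  ultimately show "decomposes J W w (\<lambda>i. if i = j then w else 0)"
    using assms subspace_0[OF subspace_summand] by (auto simp: decomposes_def)
qed

lemma components_add: "components J W (v + w) = (\<lambda>i. components J W v i + components J W w i)"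
proof (rule components_eqI)
  have "finite {i. components J W v i + components J W w i \<noteq> 0}"
    by (rule finite_subset[OF _ finite_UnI[OF finite_components[of v] finite_components[of w]]])
      auto
  then show "decomposes J W (v + w) (\<lambda>i. components J W v i + components J W w i)"
    by (simp add: decomposes_def components_mem components_outside finite_components
        Sum_any_components Sum_any.distrib subspace_add subspace_summand)
qed

lemma components_scale: "components J W (s c v) = (\<lambda>i. s c (components J W v i))"
proof (rule components_eqI)
  have "finite {i. s c (components J W v i) \<noteq> 0}"
    by (rule finite_subset[OF _ finite_components[of v]]) auto
  moreover have "s c v = Sum_any (\<lambda>i. s c (components J W v i))"
    by (subst Sum_any_hom[of "s c", symmetric])
      (simp_all add: finite_components Sum_any_components scale_right_distrib)
  ultimately show "decomposes J W (s c v) (\<lambda>i. s c (components J W v i))"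
    by (simp add: decomposes_def components_mem components_outside subspace_scale subspace_summand)
qed

lemma homogeneous_induct:
  assumes "P 0" and "\<And>j w. j \<in> J \<Longrightarrow> w \<in> W j \<Longrightarrow> P w" and "\<And>x y. P x \<Longrightarrow> P y \<Longrightarrow> P (x + y)"
  shows "P v"
proof -
  have "P (sum (components J W v) A)" if "finite A" for A
    using that
  proof induction
    case (insert i A)
    have "P (components J W v i)"
      using assms(1,2) components_mem[of i v] components_outside[of i v] by (cases "i \<in> J") auto
    with insert assms(3) show ?case by simp
  qed (use assms(1) in simp)
  from this[OF finite_components[of v]] show ?thesis
    using Sum_any_components[of v] by (simp add: Sum_any.expand_set)
qed

lemma linear_eqI:
  assumes "Vector_Spaces.linear s s' f" "Vector_Spaces.linear s s' f'"
    and "\<And>j w. j \<in> J \<Longrightarrow> w \<in> W j \<Longrightarrow> f w = f' w"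
  shows "f v = f' v"
proof (induction v rule: homogeneous_induct)
  case 1
  show ?case using assms(1,2) by (simp add: linear_0)
next
  case (3 x y)
  then show ?case using assms(1,2) by (simp add: linear_add)
qed (use assms(3) in auto)

lemma lin_ext_homogeneous:
  assumes "j \<in> J" "w \<in> W j" "\<And>i. F i 0 = 0"
  shows "lin_ext J W F w = F j w"
  unfolding lin_ext_def components_homogeneous[OF assms(1,2)]
  by (subst Sum_any_eq_single[of j]) (use assms(3) in auto)

lemma finite_lin_ext:
  assumes "\<And>i. F i 0 = 0"
  shows "finite {i. F i (components J W v i) \<noteq> 0}"
  by (rule finite_subset[OF _ finite_components[of v]]) (use assms in auto)

lemma linear_lin_ext:
  assumes "\<And>i. Vector_Spaces.linear s s' (F i)"
  shows "Vector_Spaces.linear s s' (lin_ext J W F)"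
proof -
  have z: "F i 0 = 0" for i by (rule linear_0[OF assms])
  have vs: "vector_space s'" by (rule Vector_Spaces.linear.axioms(2)[OF assms])
  interpret T: vector_space s' by fact
  have "lin_ext J W F (x + y) = lin_ext J W F x + lin_ext J W F y" for x y
    unfolding lin_ext_def
    by (simp add: components_add linear_add[OF assms] Sum_any.distrib finite_lin_ext z)
  moreover have "lin_ext J W F (s c x) = s' c (lin_ext J W F x)" for c x
  proof -
    have "lin_ext J W F (s c x) = Sum_any (\<lambda>i. s' c (F i (components J W x i)))"
      by (simp add: lin_ext_def components_scale linear_scale[OF assms])
    also have "\<dots> = s' c (lin_ext J W F x)"
      unfolding lin_ext_def
      by (rule Sum_any_hom[symmetric])
        (simp_all add: T.scale_right_distrib finite_lin_ext z)
    finally show ?thesis .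
  qed
  ultimately show ?thesis
    using vector_space_axioms vs
    by (simp add: Vector_Spaces.linear_def module_hom_def module_hom_axioms_def
        module_iff_vector_space)
qed

text \<open>The maps F i need not be additive; it is enough that f after F agrees with the linear G
  on each summand. So identities about the products of V reduce to homogeneous u without a proof
  that the products are linear in u.\<close>

lemma linear_lin_ext_eqI:
  assumes "\<And>i. F i 0 = 0" and f: "Vector_Spaces.linear s' s'' f" and G: "Vector_Spaces.linear s s'' G"
    and eq: "\<And>i w. i \<in> J \<Longrightarrow> w \<in> W i \<Longrightarrow> f (F i w) = G w"
  shows "f (lin_ext J W F v) = G v"
proof -
  let ?c = "components J W v"
  have "f (lin_ext J W F v) = Sum_any (\<lambda>i. f (F i (?c i)))"
    unfolding lin_ext_def using assms(1) by (intro linear_Sum_any[OF f] finite_lin_ext)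
  also have "f (F i (?c i)) = G (?c i)" for i
    using eq components_mem[of i v] components_outside[of i v]
    by (cases "i \<in> J") (simp_all add: assms(1) linear_0[OF f] linear_0[OF G])
  then have "Sum_any (\<lambda>i. f (F i (?c i))) = Sum_any (\<lambda>i. G (?c i))" by simp
  also have "\<dots> = G (Sum_any ?c)"
    by (rule linear_Sum_any[OF G finite_components, symmetric])
  finally show ?thesis by (simp add: Sum_any_components)
qed

text \<open>By uniqueness of components, the i-th component of f v is both \<mu> i and c times that
  of v. Applied to L(0), this shows that a weight outside the grading has no nonzero
  vectors.\<close>

lemma no_eigenvector:
  assumes "Vector_Spaces.linear s s f" and "\<And>i w. i \<in> J \<Longrightarrow> w \<in> W i \<Longrightarrow> f w = s (\<mu> i) w"
    and "f v = s c v" and "\<And>i. i \<in> J \<Longrightarrow> \<mu> i \<noteq> c"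
  shows "v = 0"
proof -
  let ?c = "components J W v"
  have f_c: "f (?c i) = s (\<mu> i) (?c i)" for i
    using assms(2) components_mem[of i v] components_outside[of i v]
    by (cases "i \<in> J") (simp_all add: linear_0[OF assms(1)])
  have "components J W (f v) = (\<lambda>i. s (\<mu> i) (?c i))"
  proof (rule components_eqI)
    have "f v = Sum_any (\<lambda>i. f (?c i))"
      using linear_Sum_any[OF assms(1) finite_components, of v] by (simp add: Sum_any_components)
    moreover have "finite {i. s (\<mu> i) (?c i) \<noteq> 0}"
      by (rule finite_subset[OF _ finite_components[of v]]) auto
    ultimately show "decomposes J W (f v) (\<lambda>i. s (\<mu> i) (?c i))"
      by (simp add: decomposes_def components_mem components_outside f_c subspace_scale
          subspace_summand)
  qed
  then have eq: "s (\<mu> i) (?c i) = s c (?c i)" for i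
    unfolding assms(3) components_scale by (rule fun_cong[OF sym])
  have "?c i = 0" for i
    using eq[of i] assms(4)[of i] components_outside[of i v] by (cases "i \<in> J") simp_all
  then have "?c = (\<lambda>_. 0)" by auto
  then show ?thesis using Sum_any_components[of v] by simp
qed

end

text \<open>Uniqueness comes from applying p i to an arbitrary decomposition: by additivity only its
  i-th term remains.\<close>

lemma direct_sum_projections:
  assumes add: "\<And>i x y. p i (x + y) = p i x + p i y"
    and mem: "\<And>i v. i \<in> J \<Longrightarrow> p i v \<in> W i" and out: "\<And>i v. i \<notin> J \<Longrightarrow> p i v = 0"
    and fin: "\<And>v. finite {i. p i v \<noteq> 0}" and sum: "\<And>v. Sum_any (\<lambda>i. p i v) = v"
    and proj: "\<And>i j w. j \<in> J \<Longrightarrow> w \<in> W j \<Longrightarrow> p i w = (if i = j then w else 0)"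
  shows "direct_sum J W"
  unfolding direct_sum_def
proof (intro allI ex1I)
  show "decomposes J W v (\<lambda>i. p i v)" for v
    using assms by (simp add: decomposes_def)
  fix v f assume f: "decomposes J W v f"
  have z: "p i 0 = 0" for i using add[of i 0 0] by simp
  have "p i v = f i" for i
  proof -
    have "p i v = Sum_any (\<lambda>j. p i (f j))"
      using f Sum_any_hom[of "p i" f] by (simp add: decomposes_def add z)
    also have "p i (f j) = (if j = i then f i else 0)" for j
      using f proj[of j "f j" i] by (cases "j \<in> J") (auto simp: decomposes_def z)
    then have "Sum_any (\<lambda>j. p i (f j)) = f i"
      by (subst Sum_any_eq_single[of i]) auto
    finally show ?thesis .
  qed
  then show "f = (\<lambda>i. p i v)" by auto
qed


section \<open>Coefficients of the Jacobi identity\<close>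

text \<open>This and the next three lemmas are where truncation enters: if the terms with i > 0
  vanish, only the leading one with binomial coefficient 1 is left. Integrality of l - \<alpha> says
  that the exponent of z0 occurs at all.\<close>

lemma delta_z1_z2_single:
  assumes "vector_space s" and "l - \<alpha> \<in> \<int>"
    and "\<And>i::nat. i \<noteq> 0 \<Longrightarrow> A (m + l - of_nat i) (k + of_nat i) = 0"
  shows "delta_z1_z2 s \<alpha> A l m k = A (m + l) k"
proof -
  interpret vector_space s by fact
  show ?thesis
    unfolding delta_z1_z2_def using assms(2,3) by (subst Sum_any_eq_single[of 0]) auto
qed

lemma delta_z1_z2_zero:
  assumes "vector_space s"
    and "\<And>i::nat. A (m + l - of_nat i) (k + of_nat i) = 0"
  shows "delta_z1_z2 s \<alpha> A l m k = 0"
proof -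
  interpret vector_space s by fact
  show ?thesis unfolding delta_z1_z2_def using assms(2) by auto
qed

lemma delta_z2_z1_single:
  assumes "vector_space s" and "l - \<alpha> \<in> \<int>"
    and "\<And>i::nat. i \<noteq> 0 \<Longrightarrow> A (m + of_nat i) (k + l - of_nat i) = 0"
  shows "delta_z2_z1 s \<alpha> A l m k = s ((-1) powi \<lfloor>Re (l - \<alpha>)\<rfloor>) (A m (k + l))"
proof -
  interpret vector_space s by fact
  show ?thesis
    unfolding delta_z2_z1_def using assms(2,3) by (subst Sum_any_eq_single[of 0]) auto
qed

lemma delta_z2_z1_zero:
  assumes "vector_space s"
    and "\<And>i::nat. A (m + of_nat i) (k + l - of_nat i) = 0"
  shows "delta_z2_z1 s \<alpha> A l m k = 0"
proof -
  interpret vector_space s by fact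
  show ?thesis unfolding delta_z2_z1_def using assms(2) by auto
qed

text \<open>For l = 0 the binomial coefficients themselves vanish for i > 0, so no truncation of A
  is required.\<close>

lemma delta_z1_z2_0:
  assumes "vector_space s"
  shows "delta_z1_z2 s 0 A 0 m k = A m k"
proof -
  interpret vector_space s by fact
  show ?thesis
    unfolding delta_z1_z2_def by (subst Sum_any_eq_single[of 0]) (auto simp: gbinomial_0_left)
qed

lemma delta_z2_z1_0:
  assumes "vector_space s"
  shows "delta_z2_z1 s 0 A 0 m k = A m k"
proof -
  interpret vector_space s by fact
  show ?thesis
    unfolding delta_z2_z1_def by (subst Sum_any_eq_single[of 0]) (auto simp: gbinomial_0_left)
qed

lemma delta_z2_z0_0_1:
  assumes "vector_space s"
  shows "delta_z2_z0 s 0 A 0 1 k = A 0 (k + 1) + A 1 k"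
proof -
  interpret vector_space s by fact
  have g: "(1 :: complex) gchoose i = of_nat (1 choose i)" for i
    using binomial_gbinomial[of 1 i, where 'a = complex] by simp
  have "Sum_any (\<lambda>i::nat. s (1 gchoose i) (A (0 + of_nat i) (1 + k - of_nat i)))
      = sum (\<lambda>i::nat. s (1 gchoose i) (A (0 + of_nat i) (1 + k - of_nat i))) {0, 1}"
  proof (rule Sum_any.expand_superset)
    show "{i. s (1 gchoose i) (A (0 + of_nat i) (1 + k - of_nat i)) \<noteq> 0} \<subseteq> {0, 1}"
    proof
      fix i :: nat
      assume "i \<in> {i. s (1 gchoose i) (A (0 + of_nat i) (1 + k - of_nat i)) \<noteq> 0}"
      then have "1 choose i \<noteq> 0" by (auto simp: g)
      then show "i \<in> {0, 1}" using binomial_eq_0[of 1 i] by force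
    qed
  qed simp
  then show ?thesis by (simp add: delta_z2_z0_def add.commute)
qed

text \<open>The \<open>L(0)\<close>-commutator formula is the coefficient \<open>(l, m) = (0, 1)\<close> for \<open>u = \<omega>\<close>, where both
  expansions on the left have a single term.\<close>

lemma Jacobi_commutator:
  assumes "vector_space s"
    and "delta_z1_z2 s 0 A 0 1 k - delta_z2_z1 s 0 B 0 1 k = delta_z2_z0 s 0 C 0 1 k"
  shows "A 1 k - B 1 k = C 0 (k + 1) + C 1 k"
  using assms(2) by (simp add: delta_z1_z2_0 delta_z2_z1_0 delta_z2_z0_0_1 assms(1))

section \<open>Products with a vector of lowest weight\<close>

text \<open>The modes \<open>y1\<close>, \<open>y2\<close>, \<open>y3\<close> of a vector of weight \<open>n\<close> and the vectors \<open>w1\<close>, \<open>w2\<close> are fixed,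
  \<open>w2\<close> being of lowest weight; \<open>e\<close> is the index of the mode of \<open>w1\<close> that preserves degree \<open>0\<close>.\<close>

locale lowest_weight_product =
  fixes s1 :: "complex \<Rightarrow> 'a::ab_group_add \<Rightarrow> 'a" and s3 :: "complex \<Rightarrow> 'c::ab_group_add \<Rightarrow> 'c"
    and y1 :: "complex \<Rightarrow> 'a \<Rightarrow> 'a" and y2 :: "complex \<Rightarrow> 'b::ab_group_add \<Rightarrow> 'b"
    and y3 :: "complex \<Rightarrow> 'c \<Rightarrow> 'c"
    and I :: "'a \<Rightarrow> complex \<Rightarrow> 'b \<Rightarrow> 'c" and top :: "'a \<Rightarrow> 'c"
    and \<alpha> \<beta> n e :: complex and w1 :: 'a and w2 :: 'b
  assumes linear_top: "Vector_Spaces.linear s1 s3 top"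
    and top_mode: "top (y1 p w1) = I (y1 p w1) (e + n - 1 - p) w2"
    and finite_modes: "finite {i::nat. y1 (of_nat i - b) w1 \<noteq> 0}"
    and jacobi: "delta_z1_z2 s3 \<alpha> (\<lambda>p q. y3 p (I w1 q w2)) l m k
        - s3 (exp (\<alpha> * complex_of_real pi * \<i>)) (delta_z2_z1 s3 \<alpha> (\<lambda>p q. I w1 q (y2 p w2)) l m k)
        = delta_z2_z0 s3 \<beta> (\<lambda>p q. I (y1 p w1) q w2) l m k"
    and lowest2: "Re (n - 1 - p) < 0 \<Longrightarrow> y2 p w2 = 0"
    and lowest3: "Re (e - q) < 0 \<Longrightarrow> I w1 q w2 = 0"
    and zero3: "y3 p 0 = 0" and zero_I: "I w1 q 0 = 0"
begin

sublocale S1: vector_space s1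
  using linear_top by (rule Vector_Spaces.linear.axioms)

sublocale S3: vector_space s3
  using linear_top by (rule Vector_Spaces.linear.axioms)

text \<open>The binomials of (1+z)^a are those of (z2+z0)^m for m = a, and the factor z^(-b) selects
  l = -b. Then k is forced by \<open>top_mode\<close>, which prescribes the sum of the indices of
  both modes. Integrality of a - \<beta> makes m an exponent that occurs on the right-hand
  side.\<close>

lemma top_res_binom:
  assumes "a - \<beta> \<in> \<int>"
  shows "top (res_binom s1 a b (\<lambda>p. y1 p w1)) =
    delta_z2_z0 s3 \<beta> (\<lambda>p q. I (y1 p w1) q w2) (- b) a (e + n + b - 1 - a)"
proof -
  have "finite {i. s1 (a gchoose i) (y1 (of_nat i - b) w1) \<noteq> 0}"
    by (rule finite_subset[OF _ finite_modes[of b]]) auto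
  then have "top (res_binom s1 a b (\<lambda>p. y1 p w1)) =
      Sum_any (\<lambda>i. s3 (a gchoose i) (top (y1 (of_nat i - b) w1)))"
    unfolding res_binom_def by (simp add: linear_Sum_any[OF linear_top] linear_scale[OF linear_top])
  also have "\<dots> = Sum_any (\<lambda>i. s3 (a gchoose i)
      (I (y1 (- b + of_nat i) w1) (a + (e + n + b - 1 - a) - of_nat i) w2))"
    by (simp add: top_mode algebra_simps)
  finally show ?thesis using assms by (simp add: delta_z2_z0_def)
qed

lemma top_res_binom_jacobi:
  assumes "a - \<beta> \<in> \<int>" and "k = e + n + b - 1 - a"
  shows "top (res_binom s1 a b (\<lambda>p. y1 p w1)) =
    delta_z1_z2 s3 \<alpha> (\<lambda>p q. y3 p (I w1 q w2)) (- b) a k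
    - s3 (exp (\<alpha> * complex_of_real pi * \<i>))
        (delta_z2_z1 s3 \<alpha> (\<lambda>p q. I w1 q (y2 p w2)) (- b) a k)"
  by (simp add: top_res_binom[OF assms(1)] jacobi assms(2))

text \<open>The mode k+i of w1 has Re (e-k-i) = Re (a-n-b+1) - i, and the mode a+i of u has Re
  (n-1-a-i) = Re (n-1-a) - i; both are negative for every i, so both expansions vanish
  termwise.\<close>

lemma top_res_binom_zero:
  assumes "a - \<beta> \<in> \<int>" and "Re (a - n - b + 1) < 0" and "Re (n - 1 - a) < 0"
  shows "top (res_binom s1 a b (\<lambda>p. y1 p w1)) = 0"
proof -
  let ?k = "e + n + b - 1 - a"
  have "I w1 (?k + of_nat i) w2 = 0" and "y2 (a + of_nat i) w2 = 0" for i
    using assms(2,3) by (auto intro!: lowest2 lowest3)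
  then show ?thesis
    by (simp add: top_res_binom_jacobi[OF assms(1) refl] delta_z1_z2_zero delta_z2_z1_zero zero3
        zero_I S3.vector_space_axioms)
qed

text \<open>Now k = e, so the first expansion keeps its term i = 0, in which u has index m + l = a -
  b = n - 1.\<close>

lemma top_res_binom_left:
  assumes "a - \<beta> \<in> \<int>" and "- b - \<alpha> \<in> \<int>" and "a - n - b + 1 = 0" and "Re (n - 1 - a) < 0"
  shows "top (res_binom s1 a b (\<lambda>p. y1 p w1)) = y3 (n - 1) (I w1 e w2)"
proof -
  have k: "e = e + n + b - 1 - a" and ab: "a + - b = n - 1"
    using assms(3) by (simp_all add: algebra_simps)
  have "I w1 (e + of_nat i) w2 = 0" if "i \<noteq> 0" for i
    using that by (auto intro!: lowest3)
  moreover have "y2 (a + of_nat i) w2 = 0" for i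
    using assms(4) by (auto intro!: lowest2)
  ultimately show ?thesis
    using ab assms(2)
    by (simp add: top_res_binom_jacobi[OF assms(1) k] delta_z1_z2_single delta_z2_z1_zero zero3
        zero_I S3.vector_space_axioms)
qed

text \<open>Now a = n - 1, so the second expansion keeps its term i = 0, in which w1 has index k + l
  = e. The exponential in front removes the phase of the Jacobi identity.\<close>

lemma top_res_binom_right:
  assumes "a - \<beta> \<in> \<int>" and "- b - \<alpha> = -1" and "Re (a - n - b + 1) < 0" and "a = n - 1"
  shows "s3 (exp (- (\<alpha> * complex_of_real pi * \<i>))) (top (res_binom s1 a b (\<lambda>p. y1 p w1))) =
    I w1 e (y2 (n - 1) w2)"
proof -
  define k where "k = e + n + b - 1 - a"
  have k: "k + - b = e" using assms(4) by (simp add: k_def)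
  have "I w1 (k + of_nat i) w2 = 0" for i
    using assms(3) by (auto intro!: lowest3 simp: k_def)
  then have 1: "delta_z1_z2 s3 \<alpha> (\<lambda>p q. y3 p (I w1 q w2)) (- b) a k = 0"
    by (intro delta_z1_z2_zero) (simp_all add: zero3 S3.vector_space_axioms)
  have "y2 (a + of_nat i) w2 = 0" if "i \<noteq> 0" for i
    using that assms(4) by (auto intro!: lowest2)
  then have 2: "delta_z2_z1 s3 \<alpha> (\<lambda>p q. I w1 q (y2 p w2)) (- b) a k =
      s3 ((-1) powi \<lfloor>Re (- b - \<alpha>)\<rfloor>) (I w1 (k + - b) (y2 a w2))"
    by (intro delta_z2_z1_single) (use assms(2) in \<open>simp_all add: zero_I S3.vector_space_axioms\<close>)
  \<comment> \<open>Here l - \<alpha> = -1, so the sign in \<open>delta_z2_z1\<close> is -1 and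
    cancels the minus in front of the second product.\<close>
  have "\<lfloor>- 1 :: real\<rfloor> = - 1" by linarith
  then have "top (res_binom s1 a b (\<lambda>p. y1 p w1)) =
      s3 (exp (\<alpha> * complex_of_real pi * \<i>)) (I w1 e (y2 (n - 1) w2))"
    unfolding top_res_binom_jacobi[OF assms(1) k_def] 1 2 unfolding k assms(2)
    using assms(4) by simp
  then show ?thesis by (simp flip: exp_add)
qed

end


section \<open>Eigenspace decompositions\<close>

lemma linearI:
  assumes "vector_space s" "vector_space s'"
    and "\<And>x y. f (x + y) = f x + f y" "\<And>c x. f (s c x) = s' c (f x)"
  shows "Vector_Spaces.linear s s' f"
  using assms
  by (simp add: Vector_Spaces.linear_def module_hom_def module_hom_axioms_def module_iff_vector_space)

lemma linear_zero_map: "vector_space s \<Longrightarrow> vector_space s' \<Longrightarrow> Vector_Spaces.linear s s' (\<lambda>_. 0)"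
  by (rule linearI) (simp_all add: module.scale_zero_right module_iff_vector_space)

lemma subspace_eigenspace:
  assumes "Vector_Spaces.linear s s f"
  shows "module.subspace s {v. f v = s c v}"
proof -
  interpret vector_space s using assms by (rule Vector_Spaces.linear.axioms)
  show ?thesis
    by (rule subspaceI)
      (simp_all add: linear_0[OF assms] linear_add[OF assms] linear_scale[OF assms]
        scale_right_distrib mult.commute)
qed

text \<open>A finite direct sum recorded through explicit projections: composing these yields common
  refinements, which the bare existence of a decomposition would not.\<close>

locale finite_projections = vector_space s
  for s :: "complex \<Rightarrow> 'v::ab_group_add \<Rightarrow> 'v" and K :: "'k set"
    and E :: "'k \<Rightarrow> 'v set" and P :: "'k \<Rightarrow> 'v \<Rightarrow> 'v" +
  assumes finite_K: "finite K"
    and linear_P: "Vector_Spaces.linear s s (P k)"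
    and P_mem: "k \<in> K \<Longrightarrow> P k v \<in> E k"
    and sum_P: "(\<Sum>k\<in>K. P k v) = v"
    and P_E: "k \<in> K \<Longrightarrow> k' \<in> K \<Longrightarrow> w \<in> E k' \<Longrightarrow> P k w = (if k = k' then w else 0)"
    and subspace_E: "k \<in> K \<Longrightarrow> subspace (E k)"
begin

text \<open>Invariance of E' k' under P k stands for commutation of the two families: it puts P k
  (P' k' v) into both subspaces.\<close>

lemma finite_projections_product:
  fixes K' :: "'l set"
  assumes "finite_projections s K' E' P'"
    and "\<And>k k' v. k \<in> K \<Longrightarrow> k' \<in> K' \<Longrightarrow> v \<in> E' k' \<Longrightarrow> P k v \<in> E' k'"
  shows "finite_projections s (K \<times> K') (\<lambda>(k, k'). E k \<inter> E' k') (\<lambda>(k, k') v. P k (P' k' v))"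
proof -
  interpret Q: finite_projections s K' E' P' by fact
  show ?thesis
  proof (intro finite_projections.intro finite_projections_axioms.intro vector_space_axioms)
    fix x :: "'k \<times> 'l" and v
    show "Vector_Spaces.linear s s ((\<lambda>(k, k') v. P k (P' k' v)) x)"
      by (cases x)
        (auto intro!: linearI simp: vector_space_axioms linear_add[OF linear_P] linear_add[OF Q.linear_P]
          linear_scale[OF linear_P] linear_scale[OF Q.linear_P])
    have "(\<Sum>x\<in>K \<times> K'. (\<lambda>(k, k') v. P k (P' k' v)) x v) = (\<Sum>k\<in>K. \<Sum>k'\<in>K'. P k (P' k' v))"
      by (simp add: sum.cartesian_product split_def)
    also have "\<dots> = (\<Sum>k'\<in>K'. \<Sum>k\<in>K. P k (P' k' v))"
      by (rule sum.swap)
    finally show "(\<Sum>x\<in>K \<times> K'. (\<lambda>(k, k') v. P k (P' k' v)) x v) = v"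
      by (simp add: sum_P Q.sum_P)
  next
    fix x y w assume "x \<in> K \<times> K'" "y \<in> K \<times> K'" "w \<in> (case y of (k, k') \<Rightarrow> E k \<inter> E' k')"
    then show "(case x of (k, k') \<Rightarrow> \<lambda>v. P k (P' k' v)) w = (if x = y then w else 0)"
      by (cases x; cases y; cases "snd x = snd y") (auto simp: P_E Q.P_E linear_0[OF linear_P])
  qed (auto simp: finite_K Q.finite_K P_mem Q.P_mem assms(2) subspace_E Q.subspace_E
      intro!: subspace_inter)
qed

lemma graded_vector_space_refine:
  assumes "graded_vector_space s J W"
    and "\<And>i k v. i \<in> J \<Longrightarrow> k \<in> K \<Longrightarrow> v \<in> W i \<Longrightarrow> P k v \<in> W i"
  shows "graded_vector_space s (J \<times> K) (\<lambda>(i, k). W i \<inter> E k)"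
proof -
  interpret G: graded_vector_space s J W by fact
  \<comment> \<open>The value 0 for k outside K is imposed by hand: decompositions must vanish off
    the index set, and the locale does not control P k there.\<close>
  define p where "p = (\<lambda>(i, k) v. if k \<in> K then P k (components J W v i) else 0)"
  have supp: "{x. p x v \<noteq> 0} \<subseteq> {i. components J W v i \<noteq> 0} \<times> K" for v
    by (auto simp: p_def linear_0[OF linear_P] split: if_splits)
  have fin: "finite ({i. components J W v i \<noteq> 0} \<times> K)" for v
    using G.finite_components finite_K by blast
  have "direct_sum (J \<times> K) (\<lambda>(i, k). W i \<inter> E k)"
  proof (rule direct_sum_projections[of p])
    fix x v w
    show "p x (v + w) = p x v + p x w"
      by (auto simp: p_def split_def G.components_add linear_add[OF linear_P])
    show "p x v \<in> (case x of (i, k) \<Rightarrow> W i \<inter> E k)" if "x \<in> J \<times> K"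
      using that assms(2) G.components_mem P_mem by (auto simp: p_def)
    show "p x v = 0" if "x \<notin> J \<times> K"
      using that by (cases x) (auto simp: p_def G.components_outside linear_0[OF linear_P])
    show "finite {x. p x v \<noteq> 0}"
      using supp fin by (rule finite_subset)
    have "Sum_any (\<lambda>x. p x v) = (\<Sum>x\<in>{i. components J W v i \<noteq> 0} \<times> K. p x v)"
      using supp fin by (intro Sum_any.expand_superset)
    also have "\<dots> = (\<Sum>i\<in>{i. components J W v i \<noteq> 0}. \<Sum>k\<in>K. P k (components J W v i))"
      by (auto simp: sum.cartesian_product p_def split_def intro!: sum.cong)
    also have "\<dots> = Sum_any (components J W v)"
      by (simp add: sum_P Sum_any.expand_set)
    finally show "Sum_any (\<lambda>x. p x v) = v"
      by (simp add: G.Sum_any_components)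
  next
    fix x y w assume "y \<in> J \<times> K" "w \<in> (case y of (i, k) \<Rightarrow> W i \<inter> E k)"
    then show "p x w = (if x = y then w else 0)"
      by (cases x; cases y) (auto simp: p_def G.components_homogeneous P_E linear_0[OF linear_P])
  qed
  then show ?thesis
    by unfold_locales (auto intro!: subspace_inter G.subspace_summand subspace_E)
qed

end

section \<open>Roots of unity and the eigenspaces of an operator of finite order\<close>

definition unity_root :: "nat \<Rightarrow> nat \<Rightarrow> complex" where
  "unity_root T r = exp (2 * complex_of_real pi * \<i> * of_nat r / of_nat T)"

lemma unity_root_cis: "unity_root T r = cis (2 * pi * real r / real T)"
  by (simp add: unity_root_def cis_conv_exp mult_ac)

lemma unity_root_power: "T \<ge> 1 \<Longrightarrow> unity_root T r ^ T = 1"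
  using cis_multiple_2pi[of "real r"] by (simp add: unity_root_cis Complex.DeMoivre)

lemma unity_root_nonzero: "unity_root T r \<noteq> 0"
  by (simp add: unity_root_def)

lemma unity_root_0: "unity_root T 0 = 1"
  by (simp add: unity_root_def)

lemma unity_root_add: "unity_root T (r + r') = unity_root T r * unity_root T r'"
  by (simp add: unity_root_cis cis_mult distrib_left add_divide_distrib)

lemma unity_root_mod: "T \<ge> 1 \<Longrightarrow> unity_root T (r mod T) = unity_root T r"
proof -
  assume T: "T \<ge> 1"
  have *: "unity_root T (T * k) = 1" for k
    using T cis_multiple_2pi[of "real k"] by (simp add: unity_root_cis mult_ac)
  have "unity_root T r = unity_root T (T * (r div T) + r mod T)" by simp
  then show ?thesis unfolding unity_root_add * by simp
qed

text \<open>Lets a sum over the eigenvalue index r, for a fixed power j, be read as a geometric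
  sum.\<close>

lemma unity_root_swap: "unity_root T r ^ j = unity_root T j ^ r"
  by (simp add: unity_root_cis Complex.DeMoivre mult_ac)

lemma unity_root_inj: "r < T \<Longrightarrow> r' < T \<Longrightarrow> unity_root T r = unity_root T r' \<longleftrightarrow> r = r'"
  using bij_betw_roots_unity[of T] by (auto simp: unity_root_cis bij_betw_def inj_on_def)

text \<open>Orthogonality of the characters of Z/T: for distinct r, r' the ratio is a T-th root of
  unity other than 1, and its geometric sum vanishes.\<close>

lemma sum_unity_roots:
  assumes "r < T" "r' < T"
  shows "(\<Sum>j<T. (unity_root T r / unity_root T r') ^ j) = (if r = r' then of_nat T else 0)"
proof (cases "r = r'")
  case False
  then have "unity_root T r / unity_root T r' \<noteq> 1"
    using assms by (simp add: unity_root_nonzero unity_root_inj)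
  moreover have "(unity_root T r / unity_root T r') ^ T = 1"
    using assms by (simp add: power_divide unity_root_power)
  ultimately show ?thesis using False by (simp add: geometric_sum)
qed (simp add: unity_root_nonzero)

text \<open>The averaging idempotent of the cyclic group generated by g, for the character with
  value \<open>unity_root T r\<close> at g (a discrete Fourier transform).\<close>

definition eigen_proj ::
  "(complex \<Rightarrow> 'v::ab_group_add \<Rightarrow> 'v) \<Rightarrow> nat \<Rightarrow> ('v \<Rightarrow> 'v) \<Rightarrow> nat \<Rightarrow> 'v \<Rightarrow> 'v" where
  "eigen_proj s T g r v = s (1 / of_nat T) (\<Sum>j<T. s (1 / unity_root T r ^ j) ((g ^^ j) v))"

locale finite_order_operator = vector_space s
  for s :: "complex \<Rightarrow> 'v::ab_group_add \<Rightarrow> 'v" and T :: nat and g :: "'v \<Rightarrow> 'v" +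
  assumes T_pos: "T \<ge> 1" and linear_g: "Vector_Spaces.linear s s g" and g_order: "g ^^ T = id"
begin

lemma linear_power: "Vector_Spaces.linear s s (g ^^ j)"
proof (induction j)
  case (Suc j)
  show ?case
    by (rule linearI)
      (simp_all add: vector_space_axioms linear_add[OF linear_g] linear_scale[OF linear_g]
        linear_add[OF Suc] linear_scale[OF Suc])
qed (rule linearI, simp_all add: vector_space_axioms)

lemma eigen_proj_invariant:
  assumes "subspace X" and "\<And>x. x \<in> X \<Longrightarrow> g x \<in> X" and "v \<in> X"
  shows "eigen_proj s T g r v \<in> X"
proof -
  have "(g ^^ j) v \<in> X" for j by (induction j) (use assms in auto)
  then show ?thesis
    unfolding eigen_proj_def by (intro subspace_scale subspace_sum assms)
qed

lemma eigen_proj_eigen: "g (eigen_proj s T g r v) = s (unity_root T r) (eigen_proj s T g r v)"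
proof -
  let ?z = "unity_root T r"
  let ?f = "\<lambda>j. s (1 / ?z ^ j) ((g ^^ j) v)"
  \<comment> \<open>Applying g shifts the summation index by one; the sum closes up because the term
    T, which enters, equals the term 0, which leaves.\<close>
  have "?f T = ?f 0"
    by (simp add: g_order unity_root_power[OF T_pos])
  then have "(\<Sum>j<T. ?f (Suc j)) = (\<Sum>j<T. ?f j)"
    using sum.lessThan_Suc_shift[of ?f T] sum.lessThan_Suc[of ?f T] by (simp add: add.commute)
  then have "s ?z (\<Sum>j<T. ?f j) = s ?z (\<Sum>j<T. ?f (Suc j))" by simp
  also have "\<dots> = (\<Sum>j<T. g (?f j))"
    by (simp add: scale_sum_right linear_scale[OF linear_g] unity_root_nonzero)
  also have "\<dots> = g (\<Sum>j<T. ?f j)"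
    by (rule module_hom.sum[OF Vector_Spaces.linear.axioms(3)[OF linear_g], symmetric])
  finally have "g (\<Sum>j<T. ?f j) = s ?z (\<Sum>j<T. ?f j)" by simp
  then show ?thesis
    by (simp add: eigen_proj_def linear_scale[OF linear_g])
qed

lemma eigen_proj_eigenvector:
  assumes "g w = s (unity_root T r') w" "r < T" "r' < T"
  shows "eigen_proj s T g r w = (if r = r' then w else 0)"
proof -
  have "(g ^^ j) w = s (unity_root T r' ^ j) w" for j
    by (induction j) (simp_all add: assms(1) linear_scale[OF linear_g] mult.commute)
  then have "eigen_proj s T g r w =
      s (1 / of_nat T) (s (\<Sum>j<T. (unity_root T r' / unity_root T r) ^ j) w)"
    by (simp add: eigen_proj_def scale_sum_left power_divide)
  also have "\<dots> = (if r = r' then w else 0)"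
    using T_pos assms by (auto simp: sum_unity_roots)
  finally show ?thesis .
qed

text \<open>After interchanging the sums, the character sum over r is T for j = 0 and 0 for every
  other power of g.\<close>

lemma sum_eigen_proj: "(\<Sum>r<T. eigen_proj s T g r v) = v"
proof -
  have "(\<Sum>r<T. 1 / unity_root T r ^ j) = (if j = 0 then of_nat T else 0)" if "j < T" for j
    using sum_unity_roots[of 0 T j] that
    by (simp add: unity_root_0 unity_root_swap[of T _ j] power_divide)
  then have "(\<Sum>j<T. s (\<Sum>r<T. 1 / unity_root T r ^ j) ((g ^^ j) v)) =
      (\<Sum>j<T. if j = 0 then s (of_nat T) v else 0)"
    by (intro sum.cong) auto
  also have "\<dots> = s (of_nat T) v"
    using T_pos by simp
  also have "(\<Sum>j<T. s (\<Sum>r<T. 1 / unity_root T r ^ j) ((g ^^ j) v)) =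
      (\<Sum>r<T. \<Sum>j<T. s (1 / unity_root T r ^ j) ((g ^^ j) v))"
    by (subst sum.swap) (simp add: scale_sum_left)
  finally have *: "(\<Sum>r<T. \<Sum>j<T. s (1 / unity_root T r ^ j) ((g ^^ j) v)) = s (of_nat T) v" .
  have "(\<Sum>r<T. eigen_proj s T g r v) =
      s (1 / of_nat T) (\<Sum>r<T. \<Sum>j<T. s (1 / unity_root T r ^ j) ((g ^^ j) v))"
    by (simp add: eigen_proj_def scale_sum_right)
  then show ?thesis unfolding * using T_pos by simp
qed

lemma linear_eigen_proj: "Vector_Spaces.linear s s (eigen_proj s T g r)"
  by (rule linearI)
    (simp_all add: vector_space_axioms eigen_proj_def linear_add[OF linear_power]
      linear_scale[OF linear_power] scale_right_distrib sum.distrib scale_sum_right mult.commute)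

lemma finite_projections_eigen:
  "finite_projections s {..<T} (\<lambda>r. {v. g v = s (unity_root T r) v}) (eigen_proj s T g)"
  by (intro finite_projections.intro finite_projections_axioms.intro vector_space_axioms)
    (simp_all add: linear_eigen_proj eigen_proj_eigen eigen_proj_eigenvector sum_eigen_proj
      subspace_eigenspace linear_g)

end

section \<open>Vertex operator algebras and their automorphisms\<close>

lemma eigen_space_eq: "eigen_space V T g r = {v. g v = scal V (unity_root T r) v}"
  by (simp add: eigen_space_def unity_root_def)

text \<open>The indices i - b lie either all in the coset c + Z, where they eventually pass the
  bound N, or all outside it, where F vanishes.\<close>

lemma finite_shifted_support:
  fixes F :: "complex \<Rightarrow> 'w::zero"
  assumes "\<And>p. p - c \<notin> \<int> \<Longrightarrow> F p = 0" and "\<And>n::int. n \<ge> N \<Longrightarrow> F (c + of_int n) = 0"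
  shows "finite {i::nat. F (of_nat i - b) \<noteq> 0}"
proof (cases "- b - c \<in> \<int>")
  case True
  then obtain m where m: "- b - c = of_int m" by (blast elim: Ints_cases)
  have "F (of_nat i - b) = 0" if "i \<ge> nat (N - m)" for i
  proof -
    have "of_nat i - b = c + of_int (m + int i)"
      unfolding of_int_add m[symmetric] by simp
    moreover have "N \<le> m + int i"
      using that by linarith
    ultimately show ?thesis using assms(2)[of "m + int i"] by metis
  qed
  then have "{i. F (of_nat i - b) \<noteq> 0} \<subseteq> {..<nat (N - m)}"
    by (metis (mono_tags, lifting) lessThan_iff linorder_not_le mem_Collect_eq subsetI)
  then show ?thesis by (rule finite_subset) simp
next
  case False
  have "F (of_nat i - b) = 0" for i
  proof (rule assms(1), rule notI)
    assume "of_nat i - b - c \<in> \<int>"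
    from Ints_diff[OF this Ints_of_nat[of i]] have "- b - c \<in> \<int>" by simp
    with False show False ..
  qed
  then show ?thesis by simp
qed

locale voa =
  fixes V :: "'v::ab_group_add voa"
  assumes voa: "vertex_operator_algebra V"
begin

lemma vector_space: "vector_space (scal V)"
  and linear_vertex: "Vector_Spaces.linear (scal V) (scal V) (\<lambda>u. mode V u n v)"
  and linear_mode: "Vector_Spaces.linear (scal V) (scal V) (mode V u n)"
  and mode_nonintegral: "n \<notin> \<int> \<Longrightarrow> mode V u n v = 0"
  and mode_truncation: "\<exists>N. \<forall>n\<ge>N. mode V u (of_int n) v = 0"
  and creation: "mode V u (-1) (vac V) = u"
  and creation_nonneg: "mode V u (of_nat i) (vac V) = 0"
  and Jacobi: "delta_z1_z2 (scal V) 0 (\<lambda>p q. mode V u p (mode V v q w)) l m k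
        - delta_z2_z1 (scal V) 0 (\<lambda>p q. mode V v q (mode V u p w)) l m k
        = delta_z2_z0 (scal V) 0 (\<lambda>p q. mode V (mode V u p v) q w) l m k"
  and translation: "mode V (vir V V (-1) u) n v = scal V (- n) (mode V u (n - 1) v)"
  and direct_sum_wt: "direct_sum UNIV (\<lambda>n::int. wt_space V V (of_int n))"
proof -
  note ax = voa[unfolded vertex_operator_algebra_def]
  note ax2 = ax[THEN conjunct2] note ax3 = ax2[THEN conjunct2] note ax4 = ax3[THEN conjunct2]
  note ax5 = ax4[THEN conjunct2] note ax6 = ax5[THEN conjunct2] note ax7 = ax6[THEN conjunct2]
  note ax8 = ax7[THEN conjunct2] note ax10 = ax8[THEN conjunct2, THEN conjunct2]
  note ax11 = ax10[THEN conjunct2]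
  show "vector_space (scal V)" by (rule ax[THEN conjunct1])
  show "Vector_Spaces.linear (scal V) (scal V) (\<lambda>u. mode V u n v)"
    by (rule ax2[THEN conjunct1, rule_format])
  show "Vector_Spaces.linear (scal V) (scal V) (mode V u n)"
    by (rule ax3[THEN conjunct1, rule_format])
  show "n \<notin> \<int> \<Longrightarrow> mode V u n v = 0"
    by (rule ax4[THEN conjunct1, rule_format])
  show "\<exists>N. \<forall>n\<ge>N. mode V u (of_int n) v = 0"
    by (rule ax5[THEN conjunct1, THEN spec, THEN spec])
  show "mode V u (-1) (vac V) = u"
    by (rule ax7[THEN conjunct1, THEN spec, THEN conjunct1])
  show "mode V u (of_nat i) (vac V) = 0"
    by (rule ax7[THEN conjunct1, THEN spec, THEN conjunct2, THEN spec])
  show "delta_z1_z2 (scal V) 0 (\<lambda>p q. mode V u p (mode V v q w)) l m k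
        - delta_z2_z1 (scal V) 0 (\<lambda>p q. mode V v q (mode V u p w)) l m k
        = delta_z2_z0 (scal V) 0 (\<lambda>p q. mode V (mode V u p v) q w) l m k"
    by (rule ax8[THEN conjunct1, rule_format])
  show "mode V (vir V V (-1) u) n v = scal V (- n) (mode V u (n - 1) v)"
    by (rule ax10[THEN conjunct1, rule_format])
  show "direct_sum UNIV (\<lambda>n::int. wt_space V V (of_int n))"
    by (rule ax11[THEN conjunct1])
qed

sublocale vector_space "scal V" by (rule vector_space)

lemma subspace_wt_space: "subspace (wt_space V V c)"
  unfolding wt_space_def vir_def by (rule subspace_eigenspace[OF linear_mode])

sublocale wt: graded_vector_space "scal V" UNIV "\<lambda>n::int. wt_space V V (of_int n)"
  by unfold_locales (simp_all add: direct_sum_wt subspace_wt_space)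

text \<open>Since L(0) is the mode 1 and L(-1) the mode 0 of the conformal vector, both terms on the
  right are modes of products of that vector with v.\<close>

lemma commutator_L0:
  "vir V V 0 (mode V v k w) - mode V v k (vir V V 0 w)
    = mode V (vir V V (-1) v) (k + 1) w + mode V (vir V V 0 v) k w"
  using Jacobi_commutator[OF vector_space Jacobi[of "conf V" v w 0 1 k]] by (simp add: vir_def)

text \<open>The derivative property turns the L(-1) term of the commutator into -(k+1) times the
  same mode, so the eigenvalues simply add up.\<close>

lemma wt_mode:
  assumes "u \<in> wt_space V V a" "w \<in> wt_space V V b"
  shows "mode V u k w \<in> wt_space V V (a + b - k - 1)"
proof -
  have "vir V V 0 (mode V u k w) = mode V u k (vir V V 0 w)
      + mode V (vir V V (-1) u) (k + 1) w + mode V (vir V V 0 u) k w"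
    using commutator_L0[of u k w] by (simp add: algebra_simps)
  also have "\<dots> = scal V b (mode V u k w) + scal V (- (k + 1)) (mode V u k w) + scal V a (mode V u k w)"
    using assms
    by (simp add: wt_space_def translation linear_scale[OF linear_mode]
        linear_scale[OF linear_vertex])
  also have "\<dots> = scal V (a + b - k - 1) (mode V u k w)"
    by (simp add: algebra_simps flip: scale_left_distrib scale_left_diff_distrib)
  finally show ?thesis by (simp add: wt_space_def)
qed

lemma finite_modes: "finite {i::nat. mode V u (of_nat i - b) w \<noteq> 0}"
proof -
  obtain N where "\<And>n. n \<ge> N \<Longrightarrow> mode V u (of_int n) w = 0" using mode_truncation by blast
  then show ?thesis
    by (intro finite_shifted_support[where c = 0 and N = N]) (simp_all add: mode_nonintegral)
qed

text \<open>Exhibits L(-1)u as a mode of u on the vacuum, the form in which it appears in Jacobi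
  identities with the vacuum and in which \<open>wt_mode\<close> gives its weight.\<close>

lemma L_minus1: "vir V V (-1) u = mode V u (-2) (vac V)"
  using translation[of u "-1" "vac V"] by (simp add: creation)

lemma wt_L_minus1:
  assumes "u \<in> wt_space V V a"
  shows "vir V V (-1) u \<in> wt_space V V (a + 1)"
proof -
  have "vac V \<in> wt_space V V 0" using voa by (simp add: vertex_operator_algebra_def)
  from wt_mode[OF assms this, of "-2"] show ?thesis by (simp add: L_minus1 add.commute)
qed

end

locale voa_aut = voa V for V :: "'v::ab_group_add voa" +
  fixes T :: nat and g :: "'v \<Rightarrow> 'v"
  assumes T_pos: "T \<ge> 1" and aut: "voa_automorphism V g" and order: "g ^^ T = id"
begin

sublocale finite_order_operator "scal V" T g
  using T_pos aut order vector_space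
  by (simp add: finite_order_operator_def finite_order_operator_axioms_def voa_automorphism_def)

lemma g_mode: "g (mode V u n v) = mode V (g u) n (g v)"
proof -
  have "(g \<circ> mode V u n \<circ> inv g) (g v) = mode V (g u) n (g v)" and "inj g"
    using aut by (simp_all add: voa_automorphism_def bij_def)
  then show ?thesis by simp
qed

lemma g_conf: "g (conf V) = conf V"
  using aut by (simp add: voa_automorphism_def)

lemma g_wt_space: "v \<in> wt_space V V c \<Longrightarrow> g v \<in> wt_space V V c"
  using g_mode[of "conf V" 1 v] by (simp add: wt_space_def vir_def g_conf linear_scale[OF linear_g])

lemma conf_eigen_space: "conf V \<in> eigen_space V T g 0"
  by (simp add: eigen_space_eq unity_root_0 g_conf)

lemma L_minus1_eigen_space: "u \<in> eigen_space V T g r \<Longrightarrow> vir V V (-1) u \<in> eigen_space V T g r"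
  by (simp add: vir_def eigen_space_eq g_mode g_conf linear_scale[OF linear_mode])

sublocale eigen: finite_projections "scal V" "{..<T}" "eigen_space V T g" "eigen_proj (scal V) T g"
  using finite_projections_eigen by (simp add: eigen_space_eq[abs_def])

lemma graded_vector_space_graded_eigen:
  "graded_vector_space (scal V) (UNIV \<times> {..<T}) (graded_eigen V T g)"
  unfolding graded_eigen_def
  by (rule eigen.graded_vector_space_refine)
    (auto intro!: eigen_proj_invariant g_wt_space subspace_wt_space wt.graded_vector_space_axioms)

end

text \<open>Because g1 and g2 commute, the averages over g1 preserve the eigenspaces of g2; because
  both fix the conformal vector, all averages preserve weights.\<close>

lemma graded_vector_space_graded_eigen2:
  assumes "voa_aut V T g1" "voa_aut V T g2" "g1 \<circ> g2 = g2 \<circ> g1"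
  shows "graded_vector_space (scal V) (UNIV \<times> {..<T} \<times> {..<T}) (graded_eigen2 V T g1 g2)"
proof -
  interpret G1: voa_aut V T g1 by fact
  interpret G2: voa_aut V T g2 by fact
  have inv: "g1 v \<in> eigen_space V T g2 j" if "v \<in> eigen_space V T g2 j" for v j
    using that fun_cong[OF assms(3), of v]
    by (simp add: eigen_space_eq linear_scale[OF G1.linear_g])
  have "finite_projections (scal V) ({..<T} \<times> {..<T})
      (\<lambda>(j1, j2). eigen_space V T g1 j1 \<inter> eigen_space V T g2 j2)
      (\<lambda>(j1, j2) v. eigen_proj (scal V) T g1 j1 (eigen_proj (scal V) T g2 j2 v))"
    by (rule G1.eigen.finite_projections_product[OF G2.eigen.finite_projections_axioms])
      (auto intro!: G1.eigen_proj_invariant inv G2.eigen.subspace_E)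
  then interpret P: finite_projections "scal V" "{..<T} \<times> {..<T}"
    "\<lambda>(j1, j2). eigen_space V T g1 j1 \<inter> eigen_space V T g2 j2"
    "\<lambda>(j1, j2) v. eigen_proj (scal V) T g1 j1 (eigen_proj (scal V) T g2 j2 v)" .
  have "graded_eigen2 V T g1 g2 = (\<lambda>(n, k). wt_space V V (of_int n) \<inter>
      (\<lambda>(j1, j2). eigen_space V T g1 j1 \<inter> eigen_space V T g2 j2) k)"
    by (auto simp: graded_eigen2_def fun_eq_iff)
  moreover have "graded_vector_space (scal V) (UNIV \<times> {..<T} \<times> {..<T})
      (\<lambda>(n, k). wt_space V V (of_int n) \<inter>
        (\<lambda>(j1, j2). eigen_space V T g1 j1 \<inter> eigen_space V T g2 j2) k)"
    by (rule P.graded_vector_space_refine)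
      (auto intro!: G1.eigen_proj_invariant G2.eigen_proj_invariant G1.g_wt_space G2.g_wt_space
        G1.subspace_wt_space G1.wt.graded_vector_space_axioms)
  ultimately show ?thesis by simp
qed


section \<open>Twisted modules\<close>

lemma linear_res_binom:
  assumes "vector_space s" and "\<And>p. Vector_Spaces.linear s s (Y p)"
    and "\<And>w. finite {i::nat. Y (of_nat i - b) w \<noteq> 0}"
  shows "Vector_Spaces.linear s s (\<lambda>w. res_binom s a b (\<lambda>p. Y p w))"
proof -
  interpret vector_space s by fact
  have fin: "finite {i. s (a gchoose i) (Y (of_nat i - b) w) \<noteq> 0}" for w
    by (rule finite_subset[OF _ assms(3)[of w]]) auto
  show ?thesis
  proof (rule linearI[OF assms(1,1)])
    show "res_binom s a b (\<lambda>p. Y p (x + y)) =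
        res_binom s a b (\<lambda>p. Y p x) + res_binom s a b (\<lambda>p. Y p y)" for x y
      unfolding res_binom_def
      by (simp add: linear_add[OF assms(2)] scale_right_distrib Sum_any.distrib[OF fin fin])
    show "res_binom s a b (\<lambda>p. Y p (s c x)) = s c (res_binom s a b (\<lambda>p. Y p x))" for c x
      unfolding res_binom_def
      using Sum_any_hom[of "s c", OF _ _ fin]
      by (simp add: linear_scale[OF assms(2)] scale_right_distrib mult.commute)
  qed
qed

lemma res_binom_zero: "vector_space s \<Longrightarrow> res_binom s a b (\<lambda>p. 0) = 0"
  by (simp add: res_binom_def module.scale_zero_right module_iff_vector_space)

lemma delta1_less: "r < T \<Longrightarrow> delta1 T r = (if r = 0 then 1 else 0)"
  by (auto simp: delta1_def dest: dvd_imp_le)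

locale graded_twisted_module = voa_aut V T g
  for V :: "'v::ab_group_add voa" and T :: nat and g :: "'v \<Rightarrow> 'v" +
  fixes h :: complex and M :: "('v, 'm::ab_group_add) vmod"
  assumes twisted: "twisted_module V T g M" and graded: "graded_generated V T h M"
begin

lemma M_vector_space: "vector_space (scal M)"
  and M_linear_vertex: "Vector_Spaces.linear (scal V) (scal M) (\<lambda>u. mode M u n w)"
  and M_linear_mode: "Vector_Spaces.linear (scal M) (scal M) (mode M u n)"
  and M_mode_zero: "r < T \<Longrightarrow> u \<in> eigen_space V T g r \<Longrightarrow> n - of_nat r / of_nat T \<notin> \<int> \<Longrightarrow>
    mode M u n w = 0"
  and M_truncation: "r < T \<Longrightarrow> u \<in> eigen_space V T g r \<Longrightarrow>
    \<exists>N. \<forall>n\<ge>N. mode M u (of_nat r / of_nat T + of_int n) w = 0"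
  and M_mode_vac: "mode M (vac V) n w = (if n = -1 then w else 0)"
  and M_Jacobi: "r < T \<Longrightarrow> u \<in> eigen_space V T g r \<Longrightarrow>
    delta_z1_z2 (scal M) 0 (\<lambda>p q. mode M u p (mode M v q w)) l m k
    - delta_z2_z1 (scal M) 0 (\<lambda>p q. mode M v q (mode M u p w)) l m k
    = delta_z2_z0 (scal M) (of_nat r / of_nat T) (\<lambda>p q. mode M (mode V u p v) q w) l m k"
proof -
  note ax = twisted[unfolded twisted_module_def weak_twisted_module_def, THEN conjunct1]
  note ax2 = ax[THEN conjunct2] note ax3 = ax2[THEN conjunct2] note ax4 = ax3[THEN conjunct2]
  note ax5 = ax4[THEN conjunct2]
  show "vector_space (scal M)" by (rule ax[THEN conjunct1])
  show "Vector_Spaces.linear (scal V) (scal M) (\<lambda>u. mode M u n w)"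
    by (rule ax2[THEN conjunct1, rule_format])
  show "Vector_Spaces.linear (scal M) (scal M) (mode M u n)"
    by (rule ax3[THEN conjunct1, rule_format])
  show "r < T \<Longrightarrow> u \<in> eigen_space V T g r \<Longrightarrow> n - of_nat r / of_nat T \<notin> \<int> \<Longrightarrow>
      mode M u n w = 0"
    using ax4[THEN conjunct1, THEN spec, of r] by blast
  show "r < T \<Longrightarrow> u \<in> eigen_space V T g r \<Longrightarrow>
      \<exists>N. \<forall>n\<ge>N. mode M u (of_nat r / of_nat T + of_int n) w = 0"
    using ax4[THEN conjunct1, THEN spec, of r] by blast
  show "mode M (vac V) n w = (if n = -1 then w else 0)"
    by (rule ax5[THEN conjunct1, rule_format])
  show "r < T \<Longrightarrow> u \<in> eigen_space V T g r \<Longrightarrow>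
      delta_z1_z2 (scal M) 0 (\<lambda>p q. mode M u p (mode M v q w)) l m k
      - delta_z2_z1 (scal M) 0 (\<lambda>p q. mode M v q (mode M u p w)) l m k
      = delta_z2_z0 (scal M) (of_nat r / of_nat T) (\<lambda>p q. mode M (mode V u p v) q w) l m k"
    using ax5[THEN conjunct2, THEN spec, of r] by simp
qed

sublocale M: vector_space "scal M" by (rule M_vector_space)

lemma M_subspace_wt_space: "M.subspace (wt_space V M c)"
  unfolding wt_space_def vir_def by (rule subspace_eigenspace[OF M_linear_mode])

sublocale deg: graded_vector_space "scal M" UNIV "deg_space V T h M"
  using graded
  by unfold_locales (simp_all add: graded_generated_def deg_space_def M_subspace_wt_space)

sublocale graded_eigen: graded_vector_space "scal V" "UNIV \<times> {..<T}" "graded_eigen V T g"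
  by (rule graded_vector_space_graded_eigen)

text \<open>The coefficient \<open>(l, m, k) = (-2, n, 0)\<close> of the Jacobi identity for \<open>u\<close> and the vacuum: both
  expansions on the left vanish, and on the right only \<open>u\<^sub>-\<^sub>2\<one> = L(-1)u\<close> and \<open>u\<^sub>-\<^sub>1\<one> = u\<close> survive.\<close>

lemma M_translation:
  assumes "r < T" "u \<in> eigen_space V T g r"
  shows "mode M (vir V V (-1) u) n w = scal M (- n) (mode M u (n - 1) w)"
proof (cases "n - of_nat r / of_nat T \<in> \<int>")
  case True
  let ?C = "\<lambda>p q. mode M (mode V u p (vac V)) q w"
  have "mode M (vac V) (-2 - of_nat i) (mode M u (n + of_nat i) w) = 0"
    and "mode M (vac V) (of_nat i) w = 0" for i
  proof -
    have "(-2 - of_nat i :: complex) \<noteq> -1"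
    proof
      assume "(-2 - of_nat i :: complex) = -1"
      then have "Re (-2 - of_nat i) = Re (-1)" by (rule arg_cong)
      then show False by simp
    qed
    then show "mode M (vac V) (-2 - of_nat i) (mode M u (n + of_nat i) w) = 0"
      by (simp add: M_mode_vac)
    have "(of_nat i :: complex) \<noteq> -1"
    proof
      assume "(of_nat i :: complex) = -1"
      then have "Re (of_nat i) = Re (-1)" by (rule arg_cong)
      then show False by simp
    qed
    then show "mode M (vac V) (of_nat i) w = 0"
      by (simp add: M_mode_vac)
  qed
  then have "0 = delta_z2_z0 (scal M) (of_nat r / of_nat T) ?C (-2) n 0"
    using M_Jacobi[OF assms, of "vac V" w "-2" n 0]
    by (simp add: delta_z1_z2_zero delta_z2_z1_zero M_vector_space linear_0[OF M_linear_mode])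
  also have "\<dots> = Sum_any (\<lambda>i::nat. scal M (n gchoose i) (?C (-2 + of_nat i) (n - of_nat i)))"
    using True by (simp add: delta_z2_z0_def)
  also have "\<dots> = sum (\<lambda>i::nat. scal M (n gchoose i) (?C (-2 + of_nat i) (n - of_nat i))) {0, 1}"
  proof (rule Sum_any.expand_superset)
    have "?C (-2 + of_nat i) q = 0" if "i \<notin> {0, 1}" for i q
    proof -
      obtain j where "i = Suc (Suc j)" using \<open>i \<notin> {0, 1}\<close> by (metis insertCI One_nat_def not0_implies_Suc)
      then have "(-2 + of_nat i :: complex) = of_nat j" by simp
      then show ?thesis by (simp add: creation_nonneg linear_0[OF M_linear_vertex])
    qed
    then show "{i. scal M (n gchoose i) (?C (-2 + of_nat i) (n - of_nat i)) \<noteq> 0} \<subseteq> {0, 1}"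
      by (metis (mono_tags, lifting) M.scale_zero_right mem_Collect_eq subsetI)
  qed simp
  also have "\<dots> = mode M (vir V V (-1) u) n w + scal M n (mode M u (n - 1) w)"
    by (simp add: creation L_minus1)
  finally show ?thesis by (simp add: eq_neg_iff_add_eq_0)
next
  case False
  \<comment> \<open>For n outside r/T + Z the right-hand coefficient is 0 by definition and says
    nothing, but there both modes vanish, as L(-1)u lies in the same eigenspace as u.\<close>
  have "n - 1 - of_nat r / of_nat T \<notin> \<int>"
  proof
    assume "n - 1 - of_nat r / of_nat T \<in> \<int>"
    from Ints_add[OF this Ints_1] show False using False by simp
  qed
  then show ?thesis
    using False assms by (simp add: M_mode_zero[of r] L_minus1_eigen_space)
qed

text \<open>The conformal vector is fixed by g, so its Jacobi identity has r = 0 and holds against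
  every v.\<close>

lemma M_commutator_L0:
  "vir V M 0 (mode M v k w) - mode M v k (vir V M 0 w)
    = mode M (vir V V (-1) v) (k + 1) w + mode M (vir V V 0 v) k w"
  using Jacobi_commutator[OF M_vector_space, of _ k] M_Jacobi[OF _ conf_eigen_space, of v w 0 1 k]
    T_pos by (simp add: vir_def)

lemma M_wt_mode:
  assumes "r < T" "u \<in> eigen_space V T g r" "u \<in> wt_space V V a" "w \<in> wt_space V M b"
  shows "mode M u k w \<in> wt_space V M (a + b - k - 1)"
proof -
  have "vir V M 0 (mode M u k w) = mode M u k (vir V M 0 w)
      + mode M (vir V V (-1) u) (k + 1) w + mode M (vir V V 0 u) k w"
    using M_commutator_L0[of u k w] by (simp add: algebra_simps)
  also have "\<dots> = scal M b (mode M u k w) + scal M (- (k + 1)) (mode M u k w) + scal M a (mode M u k w)"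
    using assms
    by (simp add: wt_space_def M_translation[OF assms(1,2)] linear_scale[OF M_linear_mode]
        linear_scale[OF M_linear_vertex])
  also have "\<dots> = scal M (a + b - k - 1) (mode M u k w)"
    by (simp add: algebra_simps flip: M.scale_left_distrib M.scale_left_diff_distrib)
  finally show ?thesis by (simp add: wt_space_def)
qed

lemma M_wt_space_zero:
  assumes "w \<in> wt_space V M c" "\<And>n::nat. c \<noteq> h + of_nat n / of_nat T"
  shows "w = 0"
  by (rule deg.no_eigenvector[of "vir V M 0" "\<lambda>n. h + of_nat n / of_nat T" _ c])
    (use assms M_linear_mode in \<open>auto simp: vir_def wt_space_def deg_space_def\<close>)

text \<open>The source of every truncation: a mode that would lower the degree below 0 gives the
  zero vector. Real parts are compared because weights are complex.\<close>

lemma M_wt_space_below: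
  assumes "w \<in> wt_space V M c" "Re (c - h) < 0"
  shows "w = 0"
proof (rule M_wt_space_zero[OF assms(1)])
  show "c \<noteq> h + of_nat n / of_nat T" for n
    using assms(2) by (auto simp: Re_divide_of_nat divide_less_0_iff)
qed

lemma M_finite_modes:
  assumes "r < T" "u \<in> eigen_space V T g r"
  shows "finite {i::nat. mode M u (of_nat i - b) w \<noteq> 0}"
proof -
  obtain N where "\<And>n. n \<ge> N \<Longrightarrow> mode M u (of_nat r / of_nat T + of_int n) w = 0"
    using M_truncation[OF assms, of w] by blast
  with M_mode_zero[OF assms] show ?thesis
    by (rule finite_shifted_support)
qed

section \<open>The action of the twisted Zhu algebra on the lowest weight space\<close>

lemma linear_o_mod_vertex: "Vector_Spaces.linear (scal V) (scal M) (\<lambda>u. o_mod V M u w)"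
  unfolding o_mod_def by (rule wt.linear_lin_ext) (rule M_linear_vertex)

lemma o_mod_homogeneous: "u \<in> wt_space V V (of_int n) \<Longrightarrow> o_mod V M u w = mode M u (of_int n - 1) w"
  unfolding o_mod_def
  by (rule wt.lin_ext_homogeneous) (simp_all add: linear_0[OF M_linear_vertex])

lemma linear_o_mod: "Vector_Spaces.linear (scal M) (scal M) (o_mod V M u)"
proof (induction u rule: wt.homogeneous_induct)
  case 1
  show ?case
    by (rule linearI) (simp_all add: M_vector_space linear_0[OF linear_o_mod_vertex])
next
  case (2 n u)
  then have "o_mod V M u = mode M u (of_int n - 1)" by (auto simp: o_mod_homogeneous)
  then show ?case by (simp add: M_linear_mode)
next
  case (3 u v)
  show ?case
    by (rule linearI)
      (simp_all add: M_vector_space linear_add[OF linear_o_mod_vertex] linear_add[OF 3(1)]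
        linear_add[OF 3(2)] linear_scale[OF 3(1)] linear_scale[OF 3(2)] M.scale_right_distrib)
qed

text \<open>The index wt u - 1 is an integer, whereas the modes of u have indices in r/T + Z with 0
  < r/T < 1.\<close>

lemma o_mod_eigen_zero:
  assumes "u \<in> wt_space V V (of_int n)" "r < T" "u \<in> eigen_space V T g r" "r \<noteq> 0"
  shows "o_mod V M u w = 0"
proof -
  have "of_int n - 1 - of_nat r / of_nat T \<notin> (\<int> :: complex set)"
  proof
    assume "of_int n - 1 - of_nat r / of_nat T \<in> (\<int> :: complex set)"
    then obtain m where m: "of_int n - 1 - of_nat r / of_nat T = (of_int m :: complex)"
      by (blast elim: Ints_cases)
    have "real r / real T = of_int (n - 1 - m)"
      using arg_cong[OF m, of Re] by (simp add: Re_divide_of_nat)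
    moreover have "0 < real r / real T" "real r / real T < 1"
      using assms by simp_all
    ultimately have "(0 :: real) < of_int (n - 1 - m)" "of_int (n - 1 - m) < (1 :: real)"
      by simp_all
    then show False
      unfolding of_int_0_less_iff of_int_less_1_iff by linarith
  qed
  then show ?thesis by (simp add: o_mod_homogeneous[OF assms(1)] M_mode_zero[OF assms(2,3)])
qed

text \<open>The index n - 1 preserves weights. The induction uses eigenvectors, not just weight
  vectors, because \<open>M_wt_mode\<close> is available only for these.\<close>

lemma o_mod_lowest:
  assumes "w \<in> wt_space V M h"
  shows "o_mod V M u w \<in> wt_space V M h"
proof (induction u rule: graded_eigen.homogeneous_induct)
  case 1
  show ?case by (simp add: linear_0[OF linear_o_mod_vertex] M.subspace_0 M_subspace_wt_space)
next
  case (2 x u)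
  then obtain n r where "u \<in> wt_space V V (of_int n)" "r < T" "u \<in> eigen_space V T g r"
    by (auto simp: graded_eigen_def)
  then show ?case
    using M_wt_mode[of r u "of_int n" w h "of_int n - 1"] assms by (simp add: o_mod_homogeneous)
next
  case (3 u v)
  then show ?case
    by (simp add: linear_add[OF linear_o_mod_vertex] M.subspace_add M_subspace_wt_space)
qed

lemma lowest_mode_zero:
  assumes "r < T" "u \<in> eigen_space V T g r" "u \<in> wt_space V V a" "w \<in> wt_space V M h"
    and "Re (a - 1 - p) < 0"
  shows "mode M u p w = 0"
  using M_wt_mode[OF assms(1-4), of p] by (rule M_wt_space_below) (use assms(5) in simp)

text \<open>The vertex operator of M itself plays the intertwining operator, with V as first module
  and M as the other two; e = m - 1 is the index in o(v).\<close>

lemma lowest_weight_product_vertex: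
  assumes "r < T" "u \<in> eigen_space V T g r" "u \<in> wt_space V V (of_int n)"
    and "r' < T" "v \<in> eigen_space V T g r'" "v \<in> wt_space V V (of_int m)"
    and "w \<in> wt_space V M h"
  shows "lowest_weight_product (scal V) (scal M) (mode V u) (mode M u) (mode M u) (mode M)
    (\<lambda>x. o_mod V M x w) 0 (of_nat r / of_nat T) (of_int n) (of_int m - 1) v w"
proof (rule lowest_weight_product.intro)
  show "o_mod V M (mode V u p v) w = mode M (mode V u p v) (of_int m - 1 + of_int n - 1 - p) w" for p
  proof (cases "p \<in> \<int>")
    case True
    then obtain k where k: "p = of_int k" by (blast elim: Ints_cases)
    have "mode V u p v \<in> wt_space V V (of_int (n + m - k - 1))"
      using wt_mode[OF assms(3,6), of p] by (simp add: k)
    from o_mod_homogeneous[OF this] show ?thesis by (simp add: k algebra_simps)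
  next
    case False
    then show ?thesis
      by (simp add: mode_nonintegral linear_0[OF linear_o_mod_vertex] linear_0[OF M_linear_vertex])
  qed
  show "delta_z1_z2 (scal M) 0 (\<lambda>p q. mode M u p (mode M v q w)) l m' k
      - scal M (exp (0 * complex_of_real pi * \<i>))
          (delta_z2_z1 (scal M) 0 (\<lambda>p q. mode M v q (mode M u p w)) l m' k)
      = delta_z2_z0 (scal M) (of_nat r / of_nat T) (\<lambda>p q. mode M (mode V u p v) q w) l m' k" for l m' k
    using M_Jacobi[OF assms(1,2)] by simp
  show "mode M v q w = 0" if "Re (of_int m - 1 - q) < 0" for q
    using assms(4-7) that by (rule lowest_mode_zero)
qed (use assms in \<open>simp_all add: linear_o_mod_vertex finite_modes linear_0[OF M_linear_mode]
    lowest_mode_zero[OF assms(1-3,7)]\<close>)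

text \<open>The two deciding numbers are r/T - 1 and -\<open>delta1 T r\<close> - r/T, both
  negative.\<close>

lemma o_mod_circ:
  assumes "w \<in> wt_space V M h"
  shows "o_mod V M (circ V T g u v) w = 0"
  unfolding circ_def
proof (rule graded_eigen.linear_lin_ext_eqI[OF _ linear_o_mod_vertex, where G = "\<lambda>_. 0"])
  fix x u
  assume "x \<in> UNIV \<times> {..<T}" "u \<in> graded_eigen V T g x"
  then obtain n r where u: "r < T" "u \<in> eigen_space V T g r" "u \<in> wt_space V V (of_int n)" "x = (n, r)"
    by (auto simp: graded_eigen_def)
  let ?a = "of_int n - 1 + delta1 T r + of_nat r / of_nat T" and ?b = "1 + delta1 T r"
  have "o_mod V M (res_binom (scal V) ?a ?b (\<lambda>p. mode V u p v)) w = 0"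
  proof (induction v rule: graded_eigen.homogeneous_induct)
    case (2 y v)
    then obtain m r' where v: "r' < T" "v \<in> eigen_space V T g r'" "v \<in> wt_space V V (of_int m)"
      by (auto simp: graded_eigen_def)
    interpret lowest_weight_product "scal V" "scal M" "mode V u" "mode M u" "mode M u" "mode M"
      "\<lambda>x. o_mod V M x w" 0 "of_nat r / of_nat T" "of_int n" "of_int m - 1" v w
      by (rule lowest_weight_product_vertex[OF u(1-3) v assms])
    show ?case
      by (rule top_res_binom_zero) (use u(1) in \<open>auto simp: delta1_less Re_divide_of_nat\<close>)
  qed (simp_all add: linear_res_binom[THEN linear_0] linear_res_binom[THEN linear_add]
      vector_space linear_mode finite_modes linear_0[OF linear_o_mod_vertex]
      linear_add[OF linear_o_mod_vertex])
  then show "o_mod V M ((case x of (n, r) \<Rightarrow> \<lambda>u. res_binom (scal V)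
      (of_int n - 1 + delta1 T r + of_nat r / of_nat T) (1 + delta1 T r) (\<lambda>p. mode V u p v)) u) w = 0"
    by (simp add: u)
qed (auto simp: linear_0[OF linear_vertex] res_binom_zero vector_space linear_zero_map M_vector_space)

text \<open>For r = 0 the deciding numbers are 0 and -1, the pattern of a left action. For r > 0 the
  product is 0 and so is o(u).\<close>

lemma o_mod_star:
  assumes "w \<in> wt_space V M h"
  shows "o_mod V M (star V T g u v) w = o_mod V M u (o_mod V M v w)"
  unfolding star_def
proof (rule graded_eigen.linear_lin_ext_eqI[OF _ linear_o_mod_vertex linear_o_mod_vertex])
  fix x u
  assume "x \<in> UNIV \<times> {..<T}" "u \<in> graded_eigen V T g x"
  then obtain n r where u: "r < T" "u \<in> eigen_space V T g r" "u \<in> wt_space V V (of_int n)" "x = (n, r)"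
    by (auto simp: graded_eigen_def)
  have "o_mod V M (res_binom (scal V) (of_int n) 1 (\<lambda>p. mode V u p v)) w = o_mod V M u (o_mod V M v w)"
    if "r = 0"
  proof (induction v rule: graded_eigen.homogeneous_induct)
    case (2 y v)
    then obtain m r' where v: "r' < T" "v \<in> eigen_space V T g r'" "v \<in> wt_space V V (of_int m)"
      by (auto simp: graded_eigen_def)
    interpret lowest_weight_product "scal V" "scal M" "mode V u" "mode M u" "mode M u" "mode M"
      "\<lambda>x. o_mod V M x w" 0 "of_nat r / of_nat T" "of_int n" "of_int m - 1" v w
      by (rule lowest_weight_product_vertex[OF u(1-3) v assms])
    have "o_mod V M (res_binom (scal V) (of_int n) 1 (\<lambda>p. mode V u p v)) w =
        mode M u (of_int n - 1) (mode M v (of_int m - 1) w)"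
      by (rule top_res_binom_left) (simp_all add: that)
    then show ?case
      by (simp add: o_mod_homogeneous[OF u(3)] o_mod_homogeneous[OF v(3)])
  qed (simp_all add: linear_res_binom[THEN linear_0] linear_res_binom[THEN linear_add]
      vector_space linear_mode finite_modes linear_0[OF linear_o_mod_vertex]
      linear_add[OF linear_o_mod_vertex] linear_0[OF linear_o_mod] linear_add[OF linear_o_mod])
  then show "o_mod V M ((case x of (n, r) \<Rightarrow> \<lambda>u. if r = 0 then res_binom (scal V) (of_int n) 1
      (\<lambda>p. mode V u p v) else 0) u) w = o_mod V M u (o_mod V M v w)"
    by (simp add: u o_mod_eigen_zero[OF u(3,1,2)] linear_0[OF linear_o_mod_vertex])
qed (auto simp: linear_0[OF linear_vertex] res_binom_zero vector_space)

text \<open>As L(-1)u has weight n + 1, its o is the mode of index n, which is -n times the mode n -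
  1 of u; L(0)u contributes +n times the same mode.\<close>

lemma o_mod_L_minus1_L0: "o_mod V M (vir V V (-1) u + vir V V 0 u) w = 0"
proof (induction u rule: graded_eigen.homogeneous_induct)
  case (2 x u)
  then obtain n r where u: "r < T" "u \<in> eigen_space V T g r" "u \<in> wt_space V V (of_int n)"
    by (auto simp: graded_eigen_def)
  have "vir V V (-1) u \<in> wt_space V V (of_int (n + 1))"
    using wt_L_minus1[OF u(3)] by simp
  from o_mod_homogeneous[OF this]
  have "o_mod V M (vir V V (-1) u) w = scal M (- of_int n) (mode M u (of_int n - 1) w)"
    using M_translation[OF u(1,2), of "of_int n" w] by simp
  moreover have "o_mod V M (vir V V 0 u) w = scal M (of_int n) (mode M u (of_int n - 1) w)"
    using u(3) by (simp add: wt_space_def linear_scale[OF linear_o_mod_vertex] o_mod_homogeneous[OF u(3)])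
  ultimately show ?case by (simp add: linear_add[OF linear_o_mod_vertex])
next
  case (3 x y)
  have "o_mod V M (vir V V (-1) (x + y) + vir V V 0 (x + y)) w =
      o_mod V M (vir V V (-1) x + vir V V 0 x) w + o_mod V M (vir V V (-1) y + vir V V 0 y) w"
    by (simp add: vir_def linear_add[OF linear_mode] linear_add[OF linear_o_mod_vertex] algebra_simps)
  with 3 show ?case by simp
qed (simp add: vir_def linear_0[OF linear_mode] linear_0[OF linear_o_mod_vertex])

lemma o_mod_O_alg:
  assumes "w \<in> wt_space V M h" "x \<in> O_alg V T g"
  shows "o_mod V M x w = 0"
proof -
  have "O_alg V T g \<subseteq> {x. o_mod V M x w = 0}"
    unfolding O_alg_def
  proof (rule span_minimal)
    show "subspace {x. o_mod V M x w = 0}"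
      by (rule subspaceI)
        (simp_all add: linear_0[OF linear_o_mod_vertex] linear_add[OF linear_o_mod_vertex]
          linear_scale[OF linear_o_mod_vertex])
  qed (auto simp: o_mod_circ[OF assms(1)] o_mod_L_minus1_L0)
  then show ?thesis using assms(2) by blast
qed

end


section \<open>Intertwining operators\<close>

locale intertwiner =
  M1: graded_twisted_module V T g1 h1 M1 + M2: graded_twisted_module V T g2 h2 M2 +
  M3: graded_twisted_module V T "g1 \<circ> g2" h3 M3
  for V :: "'v::ab_group_add voa" and T :: nat and g1 g2 :: "'v \<Rightarrow> 'v"
    and h1 h2 h3 :: complex
    and M1 :: "('v, 'a::ab_group_add) vmod" and M2 :: "('v, 'b::ab_group_add) vmod"
    and M3 :: "('v, 'c::ab_group_add) vmod" +
  fixes I :: "'a \<Rightarrow> complex \<Rightarrow> 'b \<Rightarrow> 'c"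
  assumes commute: "g1 \<circ> g2 = g2 \<circ> g1"
    and intertwining: "I \<in> intertwining_operators V T g1 g2 M1 M2 M3"
begin

lemma I_linear_left: "Vector_Spaces.linear (scal M1) (scal M3) (\<lambda>w1. I w1 n w2)"
  and I_linear_right: "Vector_Spaces.linear (scal M2) (scal M3) (I w1 n)"
  and I_Jacobi: "j1 < T \<Longrightarrow> j2 < T \<Longrightarrow> u \<in> eigen_space V T g1 j1 \<Longrightarrow> u \<in> eigen_space V T g2 j2 \<Longrightarrow>
    delta_z1_z2 (scal M3) (of_nat j1 / of_nat T) (\<lambda>p q. mode M3 u p (I w1 q w2)) l m k
    - scal M3 (exp (of_nat j1 / of_nat T * complex_of_real pi * \<i>))
        (delta_z2_z1 (scal M3) (of_nat j1 / of_nat T) (\<lambda>p q. I w1 q (mode M2 u p w2)) l m k)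
    = delta_z2_z0 (scal M3) (of_nat j2 / of_nat T) (\<lambda>p q. I (mode M1 u p w1) q w2) l m k"
  and I_translation: "I (vir V M1 (-1) w1) n w2 = scal M3 (- n) (I w1 (n - 1) w2)"
proof -
  note ax = intertwining[unfolded intertwining_operators_def mem_Collect_eq]
  note ax2 = ax[THEN conjunct2] note ax4 = ax2[THEN conjunct2, THEN conjunct2]
  show "Vector_Spaces.linear (scal M1) (scal M3) (\<lambda>w1. I w1 n w2)"
    by (rule ax[THEN conjunct1, rule_format])
  show "Vector_Spaces.linear (scal M2) (scal M3) (I w1 n)"
    by (rule ax2[THEN conjunct1, rule_format])
  show "j1 < T \<Longrightarrow> j2 < T \<Longrightarrow> u \<in> eigen_space V T g1 j1 \<Longrightarrow> u \<in> eigen_space V T g2 j2 \<Longrightarrow>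
      delta_z1_z2 (scal M3) (of_nat j1 / of_nat T) (\<lambda>p q. mode M3 u p (I w1 q w2)) l m k
      - scal M3 (exp (of_nat j1 / of_nat T * complex_of_real pi * \<i>))
          (delta_z2_z1 (scal M3) (of_nat j1 / of_nat T) (\<lambda>p q. I w1 q (mode M2 u p w2)) l m k)
      = delta_z2_z0 (scal M3) (of_nat j2 / of_nat T) (\<lambda>p q. I (mode M1 u p w1) q w2) l m k"
    using ax4[THEN conjunct1, THEN spec, of j1, THEN mp, THEN spec, of j2] by simp
  show "I (vir V M1 (-1) w1) n w2 = scal M3 (- n) (I w1 (n - 1) w2)"
    by (rule ax4[THEN conjunct2, rule_format])
qed

lemma I_commutator_L0:
  "vir V M3 0 (I w1 k w2) - I w1 k (vir V M2 0 w2)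
    = I (vir V M1 (-1) w1) (k + 1) w2 + I (vir V M1 0 w1) k w2"
  using Jacobi_commutator[OF M3.M_vector_space, of _ k]
    I_Jacobi[OF _ _ M1.conf_eigen_space M2.conf_eigen_space, of w1 w2 0 1 k] M1.T_pos
  by (simp add: vir_def)

lemma I_wt:
  assumes "w1 \<in> wt_space V M1 a" "w2 \<in> wt_space V M2 b"
  shows "I w1 k w2 \<in> wt_space V M3 (a + b - k - 1)"
proof -
  have "vir V M3 0 (I w1 k w2) = I w1 k (vir V M2 0 w2)
      + I (vir V M1 (-1) w1) (k + 1) w2 + I (vir V M1 0 w1) k w2"
    using I_commutator_L0[of w1 k w2] by (simp add: algebra_simps)
  also have "\<dots> = scal M3 b (I w1 k w2) + scal M3 (- (k + 1)) (I w1 k w2) + scal M3 a (I w1 k w2)"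
    using assms
    by (simp add: wt_space_def I_translation linear_scale[OF I_linear_left]
        linear_scale[OF I_linear_right])
  also have "\<dots> = scal M3 (a + b - k - 1) (I w1 k w2)"
    by (simp add: algebra_simps flip: M3.M.scale_left_distrib M3.M.scale_left_diff_distrib)
  finally show ?thesis by (simp add: wt_space_def)
qed

abbreviation o_I :: "'a \<Rightarrow> 'b \<Rightarrow> 'c" where
  "o_I \<equiv> o_int V T h1 h2 h3 M1 I"

lemma linear_o_I: "Vector_Spaces.linear (scal M1) (scal M3) (\<lambda>w1. o_I w1 w2)"
  unfolding o_int_def by (rule M1.deg.linear_lin_ext) (rule I_linear_left)

lemma o_I_homogeneous:
  "w1 \<in> deg_space V T h1 M1 n \<Longrightarrow> o_I w1 w2 = I w1 (of_nat n / of_nat T - 1 + (h1 + h2 - h3)) w2"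
  unfolding o_int_def
  by (rule M1.deg.lin_ext_homogeneous) (simp_all add: linear_0[OF I_linear_left])

lemma linear_o_I_right: "Vector_Spaces.linear (scal M2) (scal M3) (o_I w1)"
proof (induction w1 rule: M1.deg.homogeneous_induct)
  case 1
  show ?case
    by (rule linearI) (simp_all add: M2.M_vector_space M3.M_vector_space linear_0[OF linear_o_I])
next
  case (2 n w)
  then have "o_I w = I w (of_nat n / of_nat T - 1 + (h1 + h2 - h3))"
    by (auto simp: o_I_homogeneous)
  then show ?case by (simp add: I_linear_right)
next
  case (3 x y)
  show ?case
    by (rule linearI)
      (simp_all add: M2.M_vector_space M3.M_vector_space linear_add[OF linear_o_I] linear_add[OF 3(1)]
        linear_add[OF 3(2)] linear_scale[OF 3(1)] linear_scale[OF 3(2)] M3.M.scale_right_distrib)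
qed

text \<open>The shift h1 + h2 - h3 in the mode index makes the resulting weight exactly h3, whatever
  the degree of w1.\<close>

lemma o_I_lowest:
  assumes "w2 \<in> wt_space V M2 h2"
  shows "o_I w1 w2 \<in> wt_space V M3 h3"
proof (induction w1 rule: M1.deg.homogeneous_induct)
  case 1
  show ?case by (simp add: linear_0[OF linear_o_I] M3.M.subspace_0 M3.M_subspace_wt_space)
next
  case (2 n w)
  then show ?case
    using I_wt[of w "h1 + of_nat n / of_nat T" w2 h2 "of_nat n / of_nat T - 1 + (h1 + h2 - h3)"] assms
    by (simp add: o_I_homogeneous deg_space_def algebra_simps)
next
  case (3 x y)
  then show ?case
    by (simp add: linear_add[OF linear_o_I] M3.M.subspace_add M3.M_subspace_wt_space)
qed

lemma lowest_weight_product_intertwiner: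
  assumes "j1 < T" "j2 < T" "u \<in> eigen_space V T g1 j1" "u \<in> eigen_space V T g2 j2"
    and "u \<in> wt_space V V (of_int n)" "w1 \<in> deg_space V T h1 M1 d" "w2 \<in> wt_space V M2 h2"
  shows "lowest_weight_product (scal M1) (scal M3) (mode M1 u) (mode M2 u) (mode M3 u) I
    (\<lambda>x. o_I x w2) (of_nat j1 / of_nat T) (of_nat j2 / of_nat T) (of_int n)
    (of_nat d / of_nat T - 1 + (h1 + h2 - h3)) w1 w2"
proof (rule lowest_weight_product.intro)
  let ?e = "of_nat d / of_nat T - 1 + (h1 + h2 - h3)"
  have w1: "w1 \<in> wt_space V M1 (h1 + of_nat d / of_nat T)"
    using assms(6) by (simp add: deg_space_def)
  show "o_I (mode M1 u p w1) w2 = I (mode M1 u p w1) (?e + of_int n - 1 - p) w2" for p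
  proof -
    have wt: "mode M1 u p w1 \<in> wt_space V M1 (of_int n + (h1 + of_nat d / of_nat T) - p - 1)"
      by (rule M1.M_wt_mode[OF assms(1,3,5) w1])
    show ?thesis
    \<comment> \<open>\<open>o_int\<close> reads its mode index off the degree. If the weight of the
      product is h1 + c/T, then c/T = d/T + n - p - 1 gives the claimed index; otherwise the product
      is 0.\<close>
    proof (cases "\<exists>c::nat. of_int n + (h1 + of_nat d / of_nat T) - p - 1 = h1 + of_nat c / of_nat T")
      case True
      then obtain c :: nat
        where c: "of_int n + (h1 + of_nat d / of_nat T) - p - 1 = h1 + of_nat c / of_nat T" ..
      then have "mode M1 u p w1 \<in> deg_space V T h1 M1 c"
        using wt unfolding c by (simp add: deg_space_def)
      from o_I_homogeneous[OF this, of w2] show ?thesis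
        using c by (simp add: algebra_simps)
    next
      case False
      then have "mode M1 u p w1 = 0"
        by (intro M1.M_wt_space_zero[OF wt]) auto
      then show ?thesis by (simp add: linear_0[OF linear_o_I] linear_0[OF I_linear_left])
    qed
  qed
  show "delta_z1_z2 (scal M3) (of_nat j1 / of_nat T) (\<lambda>p q. mode M3 u p (I w1 q w2)) l m k
      - scal M3 (exp (of_nat j1 / of_nat T * complex_of_real pi * \<i>))
          (delta_z2_z1 (scal M3) (of_nat j1 / of_nat T) (\<lambda>p q. I w1 q (mode M2 u p w2)) l m k)
      = delta_z2_z0 (scal M3) (of_nat j2 / of_nat T) (\<lambda>p q. I (mode M1 u p w1) q w2) l m k" for l m k
    by (rule I_Jacobi[OF assms(1-4)])
  show "I w1 q w2 = 0" if "Re (?e - q) < 0" for q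
  proof (rule M3.M_wt_space_below)
    show "I w1 q w2 \<in> wt_space V M3 (h1 + of_nat d / of_nat T + h2 - q - 1)"
      by (rule I_wt[OF w1 assms(7)])
    show "Re (h1 + of_nat d / of_nat T + h2 - q - 1 - h3) < 0"
      using that by (simp add: algebra_simps)
  qed
qed (use assms in \<open>simp_all add: linear_o_I M1.M_finite_modes[OF assms(1,3)]
    M2.lowest_mode_zero[OF assms(2,4,5,7)] linear_0[OF M3.M_linear_mode] linear_0[OF I_linear_right]\<close>)

section \<open>The three products under o_I\<close>

sublocale graded_eigen2: graded_vector_space "scal V" "UNIV \<times> {..<T} \<times> {..<T}"
  "graded_eigen2 V T g1 g2"
  by (rule graded_vector_space_graded_eigen2[OF M1.voa_aut_axioms M2.voa_aut_axioms commute])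

text \<open>Reduces to homogeneous w1, hiding the degree in e. That o_I w1 is the mode e on all
  vectors matters for the right action, where it is applied to o(u)w2; the scalar c carries the
  phase of that action and is 1 otherwise.\<close>

lemma o_I_res_binom_eqI:
  assumes "w2 \<in> wt_space V M2 h2" "j1 < T" "j2 < T"
    and "u \<in> eigen_space V T g1 j1" "u \<in> eigen_space V T g2 j2" "u \<in> wt_space V V (of_int n)"
    and "Vector_Spaces.linear (scal M1) (scal M3) G"
    and "\<And>d e w1. lowest_weight_product (scal M1) (scal M3) (mode M1 u) (mode M2 u) (mode M3 u) I
        (\<lambda>x. o_I x w2) (of_nat j1 / of_nat T) (of_nat j2 / of_nat T) (of_int n) e w1 w2 \<Longrightarrow>
      (\<And>w. o_I w1 w = I w1 e w) \<Longrightarrow>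
      scal M3 c (o_I (res_binom (scal M1) a b (\<lambda>p. mode M1 u p w1)) w2) = G w1"
  shows "scal M3 c (o_I (res_binom (scal M1) a b (\<lambda>p. mode M1 u p w1)) w2) = G w1"
proof (rule M1.deg.linear_eqI[OF _ assms(7)])
  have lin: "Vector_Spaces.linear (scal M1) (scal M1) (\<lambda>w. res_binom (scal M1) a b (\<lambda>p. mode M1 u p w))"
    by (rule linear_res_binom[OF M1.M_vector_space M1.M_linear_mode M1.M_finite_modes[OF assms(2,4)]])
  show "Vector_Spaces.linear (scal M1) (scal M3)
      (\<lambda>w1. scal M3 c (o_I (res_binom (scal M1) a b (\<lambda>p. mode M1 u p w1)) w2))"
    by (intro linearI)
      (simp_all add: M1.M_vector_space M3.M_vector_space linear_add[OF lin] linear_scale[OF lin]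
        linear_add[OF linear_o_I] linear_scale[OF linear_o_I] M3.M.scale_right_distrib mult.commute)
  show "scal M3 c (o_I (res_binom (scal M1) a b (\<lambda>p. mode M1 u p w)) w2) = G w"
    if "w \<in> deg_space V T h1 M1 d" for d w
    by (rule assms(8)[OF lowest_weight_product_intertwiner[OF assms(2-6) that assms(1)]])
      (rule o_I_homogeneous[OF that])
qed

lemma o_I_circ:
  assumes "w2 \<in> wt_space V M2 h2"
  shows "o_I (circ_mod V T g1 g2 M1 u w1) w2 = 0"
  unfolding circ_mod_def
proof (rule graded_eigen2.linear_lin_ext_eqI[OF _ linear_o_I, where G = "\<lambda>_. 0"])
  fix x u
  assume "x \<in> UNIV \<times> {..<T} \<times> {..<T}" "u \<in> graded_eigen2 V T g1 g2 x"
  then obtain n j1 j2 where u: "j1 < T" "j2 < T" "u \<in> eigen_space V T g1 j1"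
    "u \<in> eigen_space V T g2 j2" "u \<in> wt_space V V (of_int n)" "x = (n, j1, j2)"
    by (auto simp: graded_eigen2_def)
  let ?a = "of_int n - 1 + delta1 T j2 + of_nat j2 / of_nat T :: complex"
    and ?b = "1 + delta2 T j1 j2 - of_nat j1 / of_nat T :: complex"
  have "scal M3 1 (o_I (res_binom (scal M1) ?a ?b (\<lambda>p. mode M1 u p w1)) w2) = 0"
  proof (rule o_I_res_binom_eqI[OF assms u(1-5)])
    fix e w1
    assume "lowest_weight_product (scal M1) (scal M3) (mode M1 u) (mode M2 u) (mode M3 u) I
      (\<lambda>x. o_I x w2) (of_nat j1 / of_nat T) (of_nat j2 / of_nat T) (of_int n) e w1 w2"
    then interpret lowest_weight_product "scal M1" "scal M3" "mode M1 u" "mode M2 u" "mode M3 u" I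
      "\<lambda>x. o_I x w2" "of_nat j1 / of_nat T" "of_nat j2 / of_nat T" "of_int n" e w1 w2 .
    \<comment> \<open>The first deciding number is x - 1 for j2 = 0, x + y - 2 for j2 > 0 and j1 +
      j2 at least T, and x + y - 1 otherwise: \<open>delta2\<close> is what keeps it negative in all
      cases.\<close>
    define x y where "x = real j1 / real T" and "y = real j2 / real T"
    have xy: "x < 1" "y < 1" "j2 = 0 \<Longrightarrow> y = 0" "j2 \<noteq> 0 \<Longrightarrow> 0 < y" "j1 + j2 < T \<Longrightarrow> x + y < 1"
      using u(1,2) by (simp_all add: x_def y_def flip: add_divide_distrib of_nat_add)
    have "Re (?a - of_int n - ?b + 1) = Re (delta1 T j2) + y - 1 - Re (delta2 T j1 j2) + x"
      and "Re (of_int n - 1 - ?a) = - Re (delta1 T j2) - y"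
      by (simp_all add: x_def y_def Re_divide_of_nat)
    then have "Re (?a - of_int n - ?b + 1) < 0" and "Re (of_int n - 1 - ?a) < 0"
      using xy u(2) by (auto simp: delta1_less delta2_def not_le)
    moreover have "?a - of_nat j2 / of_nat T \<in> \<int>"
      using u(2) by (auto simp: delta1_less)
    ultimately have "o_I (res_binom (scal M1) ?a ?b (\<lambda>p. mode M1 u p w1)) w2 = 0"
      by (intro top_res_binom_zero)
    then show "scal M3 1 (o_I (res_binom (scal M1) ?a ?b (\<lambda>p. mode M1 u p w1)) w2) = 0"
      by simp
  qed (simp add: linear_zero_map M1.M_vector_space M3.M_vector_space)
  then show "o_I ((case x of (n, j1, j2) \<Rightarrow> \<lambda>u. res_binom (scal M1)
      (of_int n - 1 + delta1 T j2 + of_nat j2 / of_nat T)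
      (1 + delta2 T j1 j2 - of_nat j1 / of_nat T) (\<lambda>p. mode M1 u p w1)) u) w2 = 0"
    by (simp add: u)
qed (auto simp: linear_0[OF M1.M_linear_vertex] res_binom_zero M1.M_vector_space M1.vector_space
    linear_zero_map M3.M_vector_space)

lemma o_I_left_star:
  assumes "w2 \<in> wt_space V M2 h2"
  shows "o_I (left_star V T g1 g2 M1 u w1) w2 = o_mod V M3 u (o_I w1 w2)"
  unfolding left_star_def
proof (rule graded_eigen2.linear_lin_ext_eqI[OF _ linear_o_I M3.linear_o_mod_vertex])
  fix x u
  assume "x \<in> UNIV \<times> {..<T} \<times> {..<T}" "u \<in> graded_eigen2 V T g1 g2 x"
  then obtain n j1 j2 where u: "j1 < T" "j2 < T" "u \<in> eigen_space V T g1 j1"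
    "u \<in> eigen_space V T g2 j2" "u \<in> wt_space V V (of_int n)" "x = (n, j1, j2)"
    by (auto simp: graded_eigen2_def)
  let ?a = "of_int n - 1 + delta1 T j2 + of_nat j2 / of_nat T :: complex"
    and ?b = "1 - of_nat j1 / of_nat T :: complex"
  have left: "scal M3 1 (o_I (res_binom (scal M1) ?a ?b (\<lambda>p. mode M1 u p w1)) w2) =
      o_mod V M3 u (o_I w1 w2)" if dvd: "T dvd j1 + j2"
  proof (rule o_I_res_binom_eqI[OF assms u(1-5)])
    fix e w1
    assume "lowest_weight_product (scal M1) (scal M3) (mode M1 u) (mode M2 u) (mode M3 u) I
      (\<lambda>x. o_I x w2) (of_nat j1 / of_nat T) (of_nat j2 / of_nat T) (of_int n) e w1 w2"
      and e: "\<And>w. o_I w1 w = I w1 e w"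
    then interpret lowest_weight_product "scal M1" "scal M3" "mode M1 u" "mode M2 u" "mode M3 u" I
      "\<lambda>x. o_I x w2" "of_nat j1 / of_nat T" "of_nat j2 / of_nat T" "of_int n" e w1 w2 by -
    \<comment> \<open>In both cases \<open>delta1 T j2\<close> + (j1 + j2)/T = 1, which makes the
      first deciding number 0.\<close>
    have cases: "(j1 = 0 \<and> j2 = 0) \<or> (j2 \<noteq> 0 \<and> j1 + j2 = T)"
    proof -
      obtain k where k: "j1 + j2 = T * k" using dvd by (auto elim: dvdE)
      with u(1,2) have "T * k < T * 2" by linarith
      then have "k = 0 \<or> k = 1" by auto
      with k u(1) show ?thesis by auto
    qed
    have "?a - of_int n - ?b + 1 = 0"
    proof (cases "j2 = 0")
      case False
      with cases have "of_nat j1 / of_nat T + of_nat j2 / of_nat T = (1 :: complex)"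
        using M1.T_pos by (simp flip: add_divide_distrib of_nat_add)
      then show ?thesis using u(2) False by (simp add: delta1_less algebra_simps)
    qed (use cases u(2) in \<open>auto simp: delta1_less\<close>)
    moreover have "Re (of_int n - 1 - ?a) < 0"
      using u(2) by (auto simp: delta1_less Re_divide_of_nat)
    moreover have "?a - of_nat j2 / of_nat T \<in> \<int>"
      using u(2) by (auto simp: delta1_less)
    moreover have "- ?b - of_nat j1 / of_nat T \<in> \<int>" by simp
    ultimately have "o_I (res_binom (scal M1) ?a ?b (\<lambda>p. mode M1 u p w1)) w2 =
        mode M3 u (of_int n - 1) (I w1 e w2)"
      by (intro top_res_binom_left)
    then show "scal M3 1 (o_I (res_binom (scal M1) ?a ?b (\<lambda>p. mode M1 u p w1)) w2) =
        o_mod V M3 u (o_I w1 w2)"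
      by (simp add: M3.o_mod_homogeneous[OF u(5)] e)
  next
    show "Vector_Spaces.linear (scal M1) (scal M3) (\<lambda>w1. o_mod V M3 u (o_I w1 w2))"
      by (rule linearI) (simp_all add: M1.M_vector_space M3.M_vector_space linear_add[OF linear_o_I]
          linear_scale[OF linear_o_I] linear_add[OF M3.linear_o_mod] linear_scale[OF M3.linear_o_mod])
  qed
  \<comment> \<open>Here u is an eigenvector of g1 g2 with eigenvalue different from 1, so the
    integral index wt u - 1 does not occur on M3; this matches the value 0 of the product.\<close>
  have zero: "o_mod V M3 u w = 0" if "\<not> T dvd j1 + j2" for w
  proof (rule M3.o_mod_eigen_zero[OF u(5)])
    show "(j1 + j2) mod T < T" using M1.T_pos by simp
    show "u \<in> eigen_space V T (g1 \<circ> g2) ((j1 + j2) mod T)"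
      using u(3,4) M1.T_pos
      by (simp add: eigen_space_eq unity_root_mod unity_root_add linear_scale[OF M1.linear_g] mult.commute)
    show "(j1 + j2) mod T \<noteq> 0" using that by (simp add: dvd_eq_mod_eq_0)
  qed
  show "o_I ((case x of (n, j1, j2) \<Rightarrow> \<lambda>u. if T dvd j1 + j2 then res_binom (scal M1)
      (of_int n - 1 + delta1 T j2 + of_nat j2 / of_nat T)
      (1 - of_nat j1 / of_nat T) (\<lambda>p. mode M1 u p w1) else 0) u) w2 = o_mod V M3 u (o_I w1 w2)"
    using left by (simp add: u zero linear_0[OF linear_o_I])
qed (auto simp: linear_0[OF M1.M_linear_vertex] res_binom_zero M1.M_vector_space)

text \<open>For j2 = 0 the deciding numbers are j1/T - 1 and 0. For j2 > 0 the product is 0, and so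
  is o(u) on M2.\<close>

lemma o_I_right_star:
  assumes "w2 \<in> wt_space V M2 h2"
  shows "o_I (right_star V T g1 g2 M1 w1 u) w2 = o_I w1 (o_mod V M2 u w2)"
  unfolding right_star_def
proof (rule graded_eigen2.linear_lin_ext_eqI[OF _ linear_o_I, where G = "\<lambda>u. o_I w1 (o_mod V M2 u w2)"])
  fix x u
  assume "x \<in> UNIV \<times> {..<T} \<times> {..<T}" "u \<in> graded_eigen2 V T g1 g2 x"
  then obtain n j1 j2 where u: "j1 < T" "j2 < T" "u \<in> eigen_space V T g1 j1"
    "u \<in> eigen_space V T g2 j2" "u \<in> wt_space V V (of_int n)" "x = (n, j1, j2)"
    by (auto simp: graded_eigen2_def)
  let ?a = "of_int n - 1 :: complex" and ?b = "1 - of_nat j1 / of_nat T :: complex"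
  let ?c = "exp (- (of_nat j1 / of_nat T * complex_of_real pi * \<i>))"
  have right: "scal M3 ?c (o_I (res_binom (scal M1) ?a ?b (\<lambda>p. mode M1 u p w1)) w2) =
      o_I w1 (o_mod V M2 u w2)" if "j2 = 0"
  proof (rule o_I_res_binom_eqI[OF assms u(1-5) linear_o_I])
    fix e w1
    assume "lowest_weight_product (scal M1) (scal M3) (mode M1 u) (mode M2 u) (mode M3 u) I
      (\<lambda>x. o_I x w2) (of_nat j1 / of_nat T) (of_nat j2 / of_nat T) (of_int n) e w1 w2"
      and e: "\<And>w. o_I w1 w = I w1 e w"
    then interpret lowest_weight_product "scal M1" "scal M3" "mode M1 u" "mode M2 u" "mode M3 u" I
      "\<lambda>x. o_I x w2" "of_nat j1 / of_nat T" "of_nat j2 / of_nat T" "of_int n" e w1 w2 by -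
    have "scal M3 ?c (o_I (res_binom (scal M1) ?a ?b (\<lambda>p. mode M1 u p w1)) w2) =
        I w1 e (mode M2 u (of_int n - 1) w2)"
      by (rule top_res_binom_right) (use u(1) that in \<open>simp_all add: Re_divide_of_nat\<close>)
    then show "scal M3 ?c (o_I (res_binom (scal M1) ?a ?b (\<lambda>p. mode M1 u p w1)) w2) =
        o_I w1 (o_mod V M2 u w2)"
      by (simp add: M2.o_mod_homogeneous[OF u(5)] e)
  qed
  show "o_I ((case x of (n, j1, j2) \<Rightarrow> \<lambda>u. if j2 = 0 then
      scal M1 (exp (- (of_nat j1 / of_nat T * complex_of_real pi * \<i>)))
        (res_binom (scal M1) (of_int n - 1) (1 - of_nat j1 / of_nat T) (\<lambda>p. mode M1 u p w1))
      else 0) u) w2 = o_I w1 (o_mod V M2 u w2)"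
    using right
    by (simp add: u linear_scale[OF linear_o_I] linear_0[OF linear_o_I] linear_0[OF linear_o_I_right]
        M2.o_mod_eigen_zero[OF u(5,2,4)])
next
  show "Vector_Spaces.linear (scal V) (scal M3) (\<lambda>u. o_I w1 (o_mod V M2 u w2))"
    by (rule linearI)
      (simp_all add: M1.vector_space M3.M_vector_space linear_add[OF linear_o_I_right]
        linear_scale[OF linear_o_I_right] linear_add[OF M2.linear_o_mod_vertex]
        linear_scale[OF M2.linear_o_mod_vertex])
qed (auto simp: linear_0[OF M1.M_linear_vertex] res_binom_zero M1.M_vector_space)

text \<open>The associativity defects die because o turns star products into compositions on lowest
  weight spaces. This applies since o_I w1 maps into M3(0) and o(u) preserves M2(0).\<close>

lemma o_I_O_mod:
  assumes "w2 \<in> wt_space V M2 h2" "x \<in> O_mod V T g1 g2 M1"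
  shows "o_I x w2 = 0"
proof -
  let ?Z = "{x. o_I x w2 = 0}"
  have Z: "M1.M.subspace ?Z"
    by (rule M1.M.subspaceI)
      (simp_all add: linear_0[OF linear_o_I] linear_add[OF linear_o_I] linear_scale[OF linear_o_I])
  have "O_mod' V T g1 g2 M1 \<subseteq> ?Z"
    unfolding O_mod'_def
    by (rule M1.M.span_minimal[OF _ Z]) (auto simp: o_I_circ[OF assms(1)])
  moreover have "O_mod'' V T g1 g2 M1 \<subseteq> ?Z"
    unfolding O_mod''_def Let_def
    by (rule M1.M.span_minimal[OF _ Z])
      (auto simp: linear_diff[OF linear_o_I] o_I_left_star[OF assms(1)] o_I_right_star
        assms(1) M2.o_mod_lowest M3.o_mod_star M2.o_mod_star o_I_lowest M3.o_mod_O_alg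
        M2.o_mod_O_alg linear_0[OF linear_o_I_right])
  ultimately show ?thesis
    using assms(2) M1.M.subspace_add[OF Z] unfolding O_mod_def by blast
qed

end


section \<open>The induced map on cosets\<close>

lemma the_elem_image_const:
  assumes "x \<in> X" "\<And>y. y \<in> X \<Longrightarrow> f y = c"
  shows "the_elem (f ` X) = c"
proof -
  have "f ` X = {c}" using assms by auto
  then show ?thesis by simp
qed

context intertwiner
begin

abbreviation "N \<equiv> O_mod V T g1 g2 M1"
abbreviation "D \<equiv> wt_space V M2 h2"

definition restricted :: "'a \<Rightarrow> 'b \<Rightarrow> 'c" where
  "restricted w = restrict (o_I w) D"

text \<open>Defined on every set, not only on cosets: the quotient operations are unions of cosets,
  and the map can be evaluated on such a union, once \<open>restricted\<close> is constant there,
  without identifying it as a single coset.\<close>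

definition class_map :: "'a set \<Rightarrow> 'b \<Rightarrow> 'c" where
  "class_map X = the_elem (restricted ` X)"

lemma class_map_eqI:
  assumes "X \<noteq> {}" "\<And>w. w \<in> X \<Longrightarrow> restricted w = f"
  shows "class_map X = f"
proof -
  obtain x where "x \<in> X" using assms(1) by blast
  then show ?thesis unfolding class_map_def using assms(2) by (rule the_elem_image_const)
qed

lemma zero_mem_N: "0 \<in> N"
proof -
  have "0 + 0 \<in> N"
    unfolding O_mod_def O_mod'_def O_mod''_def Let_def by (blast intro: M1.M.span_zero)
  then show ?thesis by simp
qed

lemma coset_refl: "x \<in> coset N x"
  using zero_mem_N by (force simp: coset_def)

lemma restricted_coset: "y \<in> coset N x \<Longrightarrow> restricted y = restricted x"
  by (auto simp: coset_def restricted_def linear_add[OF linear_o_I] o_I_O_mod)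

lemma class_map_coset: "class_map (coset N x) = restricted x"
  by (rule class_map_eqI) (use coset_refl restricted_coset in blast)+

lemma class_map_lift_coset2:
  assumes "X \<noteq> {}" "Y \<noteq> {}" "\<And>x y. x \<in> X \<Longrightarrow> y \<in> Y \<Longrightarrow> restricted (f x y) = r"
  shows "class_map (lift_coset2 N f X Y) = r"
proof (rule class_map_eqI)
  show "lift_coset2 N f X Y \<noteq> {}"
    using assms(1,2) coset_refl unfolding lift_coset2_def by blast
  fix w assume "w \<in> lift_coset2 N f X Y"
  then obtain x y where "x \<in> X" "y \<in> Y" "w \<in> coset N (f x y)"
    unfolding lift_coset2_def by blast
  then show "restricted w = r" using assms(3) restricted_coset[of w "f x y"] by simp
qed

text \<open>Independence of the representative for the two actions on lowest weight spaces, so that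
  \<open>the_elem\<close> in \<open>Hom_bimod\<close> is applied to singletons.\<close>

lemma o_mod_coset_O_alg:
  "x \<in> wt_space V M3 h3 \<Longrightarrow> u \<in> coset (O_alg V T (g1 \<circ> g2)) u0 \<Longrightarrow> o_mod V M3 u x = o_mod V M3 u0 x"
  "y \<in> D \<Longrightarrow> v \<in> coset (O_alg V T g2) v0 \<Longrightarrow> o_mod V M2 v y = o_mod V M2 v0 y"
  by (auto simp: coset_def linear_add[OF M3.linear_o_mod_vertex] M3.o_mod_O_alg
      linear_add[OF M2.linear_o_mod_vertex] M2.o_mod_O_alg)

lemma coset_O_alg_refl: "u \<in> coset (O_alg V T g) u"
  using M1.span_zero by (force simp: coset_def O_alg_def)

lemma class_map_epi:
  "class_map \<in> bimodule_epi (A_alg V T (g1 \<circ> g2)) (A_alg V T g2)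
    (A_bimod V T g1 g2 M1) (S_bimod V T h1 h2 h3 M1 M2 M3 I)"
proof -
  let ?X = "A_bimod V T g1 g2 M1" and ?Y = "S_bimod V T h1 h2 h3 M1 M2 M3 I"
  have X: "bcarrier ?X = range (coset N)" "badd ?X = lift_coset2 N (+)"
    "bscal ?X c K = (\<Union>w\<in>K. coset N (scal M1 c w))"
    "lact ?X = lift_coset2 N (left_star V T g1 g2 M1)"
    "ract ?X = lift_coset2 N (right_star V T g1 g2 M1)" for c K
    by (simp_all add: A_bimod_def Let_def)
  have Y: "bcarrier ?Y = range restricted" "badd ?Y f f' = (\<lambda>x\<in>D. f x + f' x)"
    "bscal ?Y c f = (\<lambda>x\<in>D. scal M3 c (f x))"
    "lact ?Y a f = the_elem ((\<lambda>u. \<lambda>x\<in>D. o_mod V M3 u (f x)) ` a)"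
    "ract ?Y f a = the_elem ((\<lambda>v. \<lambda>x\<in>D. f (o_mod V M2 v x)) ` a)" for f f' c a
    by (simp_all add: S_bimod_def Hom_bimod_def Let_def restricted_def[abs_def])
  have add: "class_map (badd ?X (coset N x) (coset N y)) = badd ?Y (restricted x) (restricted y)" for x y
    unfolding X
  proof (rule class_map_lift_coset2)
    fix x' y' assume "x' \<in> coset N x" "y' \<in> coset N y"
    then have "restricted x' = restricted x" "restricted y' = restricted y"
      by (simp_all add: restricted_coset)
    moreover have "restricted (x' + y') = badd ?Y (restricted x') (restricted y')"
      by (auto simp: Y restricted_def linear_add[OF linear_o_I])
    ultimately show "restricted (x' + y') = badd ?Y (restricted x) (restricted y)" by simp
  qed (use coset_refl in blast)+
  have scale: "class_map (bscal ?X c (coset N x)) = bscal ?Y c (restricted x)" for c x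
    unfolding X
  proof (rule class_map_eqI)
    show "(\<Union>w\<in>coset N x. coset N (scal M1 c w)) \<noteq> {}" using coset_refl by blast
    fix y assume "y \<in> (\<Union>w\<in>coset N x. coset N (scal M1 c w))"
    then obtain x' where x': "x' \<in> coset N x" "y \<in> coset N (scal M1 c x')" by blast
    have "restricted y = restricted (scal M1 c x')" using x'(2) by (rule restricted_coset)
    also have "\<dots> = bscal ?Y c (restricted x')"
      by (auto simp: Y restricted_def linear_scale[OF linear_o_I])
    finally show "restricted y = bscal ?Y c (restricted x)"
      by (simp add: restricted_coset[OF x'(1)])
  qed
  have left: "class_map (lact ?X a (coset N x)) = lact ?Y a (restricted x)"
    if aA: "a \<in> A_alg V T (g1 \<circ> g2)" for a x
  proof -
    obtain u0 where a: "a = coset (O_alg V T (g1 \<circ> g2)) u0" using aA unfolding A_alg_def by blast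
    \<comment> \<open>Both sides are brought to the action of one fixed representative u0 of
      a.\<close>
    have "lact ?Y a (restricted x) = (\<lambda>y\<in>D. o_mod V M3 u0 (restricted x y))"
      unfolding Y
    proof (rule the_elem_image_const)
      show "u0 \<in> a" using coset_O_alg_refl by (simp add: a)
      show "(\<lambda>y\<in>D. o_mod V M3 u (restricted x y)) = (\<lambda>y\<in>D. o_mod V M3 u0 (restricted x y))"
        if "u \<in> a" for u
        using that by (auto simp: a restricted_def o_I_lowest intro!: restrict_ext o_mod_coset_O_alg)
    qed
    moreover have "class_map (lact ?X a (coset N x)) = (\<lambda>y\<in>D. o_mod V M3 u0 (restricted x y))"
      unfolding X
    proof (rule class_map_lift_coset2)
      fix u x' assume u: "u \<in> a" and "x' \<in> coset N x"
      then have "restricted x' = restricted x" by (simp add: restricted_coset)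
      moreover have "restricted (left_star V T g1 g2 M1 u x') = (\<lambda>y\<in>D. o_mod V M3 u0 (restricted x' y))"
        using u by (auto simp: a restricted_def o_I_left_star o_I_lowest intro!: restrict_ext o_mod_coset_O_alg)
      ultimately show "restricted (left_star V T g1 g2 M1 u x') =
          (\<lambda>y\<in>D. o_mod V M3 u0 (restricted x y))" by simp
    qed (use a coset_refl coset_O_alg_refl in blast)+
    ultimately show ?thesis by simp
  qed
  have right: "class_map (ract ?X (coset N x) b) = ract ?Y (restricted x) b"
    if bA: "b \<in> A_alg V T g2" for b x
  proof -
    obtain v0 where b: "b = coset (O_alg V T g2) v0" using bA unfolding A_alg_def by blast
    have "ract ?Y (restricted x) b = (\<lambda>y\<in>D. restricted x (o_mod V M2 v0 y))"
      unfolding Y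
    proof (rule the_elem_image_const)
      show "v0 \<in> b" using coset_O_alg_refl by (simp add: b)
      show "(\<lambda>y\<in>D. restricted x (o_mod V M2 v y)) = (\<lambda>y\<in>D. restricted x (o_mod V M2 v0 y))"
        if "v \<in> b" for v
        by (rule restrict_ext) (use that o_mod_coset_O_alg(2) in \<open>simp add: b\<close>)
    qed
    moreover have "class_map (ract ?X (coset N x) b) = (\<lambda>y\<in>D. restricted x (o_mod V M2 v0 y))"
      unfolding X
    proof (rule class_map_lift_coset2)
      fix x' v assume "x' \<in> coset N x" and v: "v \<in> b"
      then have "restricted x' = restricted x" by (simp add: restricted_coset)
      \<comment> \<open>\<open>restricted x'\<close> is undefined off M2(0), so o(v0)y must first be
        known to stay in M2(0).\<close>
      moreover have "restricted (right_star V T g1 g2 M1 x' v) = (\<lambda>y\<in>D. restricted x' (o_mod V M2 v0 y))"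
        unfolding restricted_def
        by (rule restrict_ext)
          (use v o_mod_coset_O_alg(2) in \<open>simp add: b o_I_right_star M2.o_mod_lowest\<close>)
      ultimately show "restricted (right_star V T g1 g2 M1 x' v) =
          (\<lambda>y\<in>D. restricted x (o_mod V M2 v0 y))" by simp
    qed (use b coset_refl coset_O_alg_refl in blast)+
    ultimately show ?thesis by simp
  qed
  have "class_map ` bcarrier ?X = bcarrier ?Y"
    by (simp add: X Y image_image class_map_coset)
  then show ?thesis
    unfolding bimodule_epi_def bimodule_hom_def
    using add scale left right by (auto simp: X(1) Y(1) class_map_coset)
qed

end

theorem proposition3p11:
  fixes V :: "'v::ab_group_add voa"
    and T :: nat
    and g1 g2 g3 :: "'v \<Rightarrow> 'v"
    and M1 :: "('v, 'a::ab_group_add) vmod"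
    and M2 :: "('v, 'b::ab_group_add) vmod"
    and M3 :: "('v, 'c::ab_group_add) vmod"
    and h1 h2 h3 :: complex
    and I :: "'a \<Rightarrow> complex \<Rightarrow> 'b \<Rightarrow> 'c"
  assumes "vertex_operator_algebra V"
    and "T \<ge> 1"
    and "voa_automorphism V g1" and "voa_automorphism V g2" and "voa_automorphism V g3"
    and "g1 \<circ> g2 = g2 \<circ> g1" and "g1 \<circ> g3 = g3 \<circ> g1" and "g2 \<circ> g3 = g3 \<circ> g2"
    and "g1 ^^ T = id" and "g2 ^^ T = id" and "g3 ^^ T = id"
    and "g3 = g1 \<circ> g2"
    and "twisted_module V T g1 M1" and "twisted_module V T g2 M2" and "twisted_module V T g3 M3"
    and "graded_generated V T h1 M1" and "graded_generated V T h2 M2" and "graded_generated V T h3 M3"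
    and "I \<in> intertwining_operators V T g1 g2 M1 M2 M3"
  shows "\<exists>\<phi>. \<phi> \<in> bimodule_epi (A_alg V T (g1 \<circ> g2)) (A_alg V T g2)
                    (A_bimod V T g1 g2 M1) (S_bimod V T h1 h2 h3 M1 M2 M3 I)"
proof -
  interpret intertwiner V T g1 g2 h1 h2 h3 M1 M2 M3 I
    using assms by unfold_locales simp_all
  show ?thesis by (rule exI) (rule class_map_epi)
qed

end
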